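(* Let $P_\theta^{(n)}=\bigotimes_{i=1}^nP_{\theta,i}$ be product measures and let $d_n$ be defined by $$d_n^2(\theta,\theta')=\frac1n\sum_{i=1}^n\int\bigl(\sqrt{p_{\theta,i}}-\sqrt{p_{\theta',i}}\bigr)^2d\mu_i.$$ Suppose that for a sequence $\varepsilon_n\to0$ ($\varepsilon_n>0$) such that $n\varepsilon_n^2$ is bounded away from zero, some $k\ge2$, all sufficiently large $j\in\mathbb{N}$ and sets $\Theta_n\subset\Theta$, the following conditions hold: $$\sup_{\varepsilon>\varepsilon_n}\log N\bigl(\varepsilon/36,\{\theta\in\Theta_n:d_n(\theta,\theta_0)<\varepsilon\},d_n\bigr)\le n\varepsilon_n^2;$$ $$\frac{\Pi_n(\Theta\setminus\Theta_n)}{\Pi_n(B_n^*(\theta_0,\varepsilon_n;k))}=o(e^{-2n\varepsilon_n^2});$$ $$\frac{\Pi_n(\theta\in\Theta_n:j\varepsilon_n<d_n(\theta,\theta_0)\le2j\varepsilon_n)}{\Pi_n(B_n^*(\theta_0,\varepsilon_n;k))}\le e^{n\varepsilon_n^2j^2/4}.$$ Then $P_{\theta_0}^{(n)}\Pi_n(\theta:d_n(\theta,\theta_0)\ge M_n\varepsilon_n\mid X^{(n)})\to0$ for every $M_n\to\infty$.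
   Context: The observation $X^{(n)}=(X_1,\dots,X_n)$ consists of independent components; $X_i$ takes values in a measurable space $(\mathfrak{X}_i,\mathcal{A}_i)$ and, under $\theta\in\Theta$, has law $P_{\theta,i}$ with density $p_{\theta,i}$ relative to a $\sigma$-finite measure $\mu_i$. $\Theta$ is an arbitrary set with a $\sigma$-field, the densities are jointly measurable in observation and parameter, $\Pi_n$ is a prior probability measure on $\Theta$, $\Pi_n(\cdot\mid X^{(n)})$ the posterior given by Bayes' formula $\Pi_n(B\mid X^{(n)})=\int_B\prod_ip_{\theta,i}(X_i)\,d\Pi_n(\theta)/\int_\Theta\prod_ip_{\theta,i}(X_i)\,d\Pi_n(\theta)$, and $\theta_0\in\Theta$ is the fixed true parameter. Relevant sets are taken measurable. $Pf$ abbreviates $\int f\,dP$. With $K(f,g)=\int f\log(f/g)\,d\mu$ and $V_{k,0}(f,g)=\int f|\log(f/g)-K(f,g)|^kd\mu$, put $K_i(\theta_0,\theta)=K(p_{\theta_0,i},p_{\theta,i})$ and $V_{k,0;i}(\theta_0,\theta)=V_{k,0}(p_{\theta_0,i},p_{\theta,i})$. For $k\ge2$ let $C_k$ be a constant depending only on $k$ such that, for every $n$, the mean $\bar Y_n$ of any $n$ independent random variables $Y_1,\dots,Y_n$ satisfies $E|\bar Y_n-E\bar Y_n|^k\le C_kn^{-k/2}\frac1n\sum_{i=1}^nE|Y_i|^k$ (Marcinkiewicz–Zygmund inequality). Define $$B_n^*(\theta_0,\varepsilon;k)=\Bigl\{\theta\in\Theta:\frac1n\sum_{i=1}^nK_i(\theta_0,\theta)\le\varepsilon^2,\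 \frac1n\sum_{i=1}^nV_{k,0;i}(\theta_0,\theta)\le C_k^{-1}\varepsilon^k\Bigr\}.$$ $N(\varepsilon,A,d)$ is the minimal number of $d$-balls of radius $\varepsilon$ needed to cover $A$. *)

theory Defs
  imports "HOL-Probability.Probability" "HOL-Library.Landau_Symbols"
begin

(*
  Conventions.  The components of the observation are numbered 0, ..., n - 1.  The spaces X_i are
  the measurable spaces underlying mu i; they may differ, being arbitrary subsets of the common
  ambient type 'x.  The parameter set is space T with sigma-field sets T; the measure that T carries
  as an element of the type "measure" is never used.
*)

definition law :: "(nat \<Rightarrow> 'x measure) \<Rightarrow> ('p \<Rightarrow> nat \<Rightarrow> 'x \<Rightarrow> real) \<Rightarrow> 'p \<Rightarrow> nat \<Rightarrow> 'x measure" where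
  "law \<mu> p \<theta> i = density (\<mu> i) (\<lambda>x. ennreal (p \<theta> i x))"

definition joint_law ::
    "(nat \<Rightarrow> 'x measure) \<Rightarrow> ('p \<Rightarrow> nat \<Rightarrow> 'x \<Rightarrow> real) \<Rightarrow> nat \<Rightarrow> 'p \<Rightarrow> (nat \<Rightarrow> 'x) measure" where
  "joint_law \<mu> p n \<theta> = PiM {..<n} (law \<mu> p \<theta>)"

definition likelihood :: "('p \<Rightarrow> nat \<Rightarrow> 'x \<Rightarrow> real) \<Rightarrow> nat \<Rightarrow> 'p \<Rightarrow> (nat \<Rightarrow> 'x) \<Rightarrow> real" where
  "likelihood p n \<theta> X = (\<Prod>i<n. p \<theta> i (X i))"

(*
  Bayes' formula.  The quotient is taken in ennreal; the degenerate values 0 / 0 and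
  infinity / infinity are 0 there, so the value is always at most 1 for measurable B.
*)
definition posterior ::
    "('p \<Rightarrow> nat \<Rightarrow> 'x \<Rightarrow> real) \<Rightarrow> nat \<Rightarrow> 'p measure \<Rightarrow> (nat \<Rightarrow> 'x) \<Rightarrow> 'p set \<Rightarrow> ennreal" where
  "posterior p n prior X B =
     (\<integral>\<^sup>+\<theta>\<in>B. ennreal (likelihood p n \<theta> X) \<partial>prior) / (\<integral>\<^sup>+\<theta>. ennreal (likelihood p n \<theta> X) \<partial>prior)"

(* log (a / b) for a, b \<ge> 0 with values in [-\<infinity>, \<infinity>].  The value for a = b = 0 is irrelevant: below
   it is always multiplied by a = 0. *)
definition log_ratio :: "real \<Rightarrow> real \<Rightarrow> ereal" where
  "log_ratio a b = (if b = 0 then \<infinity> else if a = 0 then -\<infinity> else ereal (ln (a / b)))"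

(*
  The integral of f log (f / g) as an extended real, i.e. positive part minus negative part.  For
  probability densities the negative part has integral at most 1, so this is well defined, and it
  equals \<infinity> if f is not absolutely continuous with respect to g.  (KL_divergence of the library is
  real-valued and would yield a finite default value in that case.)
*)
definition KL :: "'x measure \<Rightarrow> ('x \<Rightarrow> real) \<Rightarrow> ('x \<Rightarrow> real) \<Rightarrow> ereal" where
  "KL M f g =
     enn2ereal (\<integral>\<^sup>+x. e2ennreal (ereal (f x) * log_ratio (f x) (g x)) \<partial>M)
     - enn2ereal (\<integral>\<^sup>+x. e2ennreal (- (ereal (f x) * log_ratio (f x) (g x))) \<partial>M)"

definition abs_powr :: "ereal \<Rightarrow> real \<Rightarrow> ennreal" where
  "abs_powr z k = (if \<bar>z\<bar> = \<infinity> then \<infinity> else ennreal (\<bar>real_of_ereal z\<bar> powr k))"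

(* V_{k,0}; when KL M f g = \<infinity> the integrand is \<infinity> wherever f > 0. *)
definition KL_var :: "real \<Rightarrow> 'x measure \<Rightarrow> ('x \<Rightarrow> real) \<Rightarrow> ('x \<Rightarrow> real) \<Rightarrow> ennreal" where
  "KL_var k M f g =
     (\<integral>\<^sup>+x. ennreal (f x) * abs_powr (log_ratio (f x) (g x) - KL M f g) k \<partial>M)"

(*
  C is an admissible constant in the Marcinkiewicz-Zygmund inequality for exponent k.  Taking
  probability spaces over nat \<Rightarrow> real loses no generality, since the inequality only involves the joint
  law of Y_0, ..., Y_{n-1}, and every such law is realised on this type by the coordinates.
  Sequences with E |Y_i|^k = \<infinity> for some i are left out: for them the inequality is trivial.
*)
definition mz_constant :: "real \<Rightarrow> real \<Rightarrow> bool" where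
  "mz_constant k C \<longleftrightarrow>
     (\<forall>n\<ge>1. \<forall>(M :: (nat \<Rightarrow> real) measure) (Y :: nat \<Rightarrow> (nat \<Rightarrow> real) \<Rightarrow> real).
        prob_space M \<longrightarrow>
        prob_space.indep_vars M (\<lambda>_. borel) Y {..<n} \<longrightarrow>
        (\<forall>i<n. integrable M (\<lambda>\<omega>. \<bar>Y i \<omega>\<bar> powr k)) \<longrightarrow>
        (let Ybar = (\<lambda>\<omega>. (\<Sum>i<n. Y i \<omega>) / real n) in
          (LINT \<omega>|M. \<bar>Ybar \<omega> - (LINT \<omega>'|M. Ybar \<omega>')\<bar> powr k)
            \<le> C * real n powr (- (k / 2)) * ((\<Sum>i<n. LINT \<omega>|M. \<bar>Y i \<omega>\<bar> powr k) / real n)))"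

definition KL_nbhd ::
    "(nat \<Rightarrow> 'x measure) \<Rightarrow> ('p \<Rightarrow> nat \<Rightarrow> 'x \<Rightarrow> real) \<Rightarrow> 'p set \<Rightarrow> real \<Rightarrow> nat \<Rightarrow> 'p \<Rightarrow> real \<Rightarrow> real \<Rightarrow> 'p set" where
  "KL_nbhd \<mu> p \<Theta> C n \<theta>\<^sub>0 \<epsilon> k =
     {\<theta> \<in> \<Theta>. (\<Sum>i<n. KL (\<mu> i) (p \<theta>\<^sub>0 i) (p \<theta> i)) / ereal (real n) \<le> ereal (\<epsilon>\<^sup>2) \<and>
             (\<Sum>i<n. KL_var k (\<mu> i) (p \<theta>\<^sub>0 i) (p \<theta> i)) / ennreal (real n) \<le> ennreal (inverse C * \<epsilon> powr k)}"

definition hellinger_avg ::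
    "(nat \<Rightarrow> 'x measure) \<Rightarrow> ('p \<Rightarrow> nat \<Rightarrow> 'x \<Rightarrow> real) \<Rightarrow> nat \<Rightarrow> 'p \<Rightarrow> 'p \<Rightarrow> real" where
  "hellinger_avg \<mu> p n \<theta> \<theta>' =
     sqrt ((\<Sum>i<n. LINT x|\<mu> i. (sqrt (p \<theta> i x) - sqrt (p \<theta>' i x))\<^sup>2) / real n)"

(* Open balls, with centres anywhere in the ambient set S; the value is \<infinity> if no finite cover exists. *)
definition covering_number :: "'p set \<Rightarrow> ('p \<Rightarrow> 'p \<Rightarrow> real) \<Rightarrow> real \<Rightarrow> 'p set \<Rightarrow> enat" where
  "covering_number S d r A =
     Inf {enat (card F) | F. finite F \<and> F \<subseteq> S \<and> A \<subseteq> (\<Union>c\<in>F. {\<theta> \<in> S. d \<theta> c < r})}"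

definition log_enat :: "enat \<Rightarrow> ereal" where
  "log_enat N = (case N of enat m \<Rightarrow> (if m = 0 then -\<infinity> else ereal (ln (real m))) | \<infinity> \<Rightarrow> \<infinity>)"

end

(*
  The parameters outside the ball are split into shells j eps < d <= (j+1) eps.  In each shell, a finite
  cover by small Hellinger balls supplies tests of theta_0 against the balls, built from the bounded
  statistic prod_i (b + a/10) / (a + b/10), where a and b are the square roots of the densities of
  theta_0 and of the centre.  Its mean under theta_0 is exponentially small, and, since its factors stay
  in [1/10, 10], so is the mean of its inverse under every parameter close to the centre.

  The denominator of the posterior is bounded below by a Markov inequality for the k-th moment of the centred log-likelihood ratio, averaged
  over the Kullback-Leibler neighbourhood; the moment is controlled by the Marcinkiewicz-Zygmund
  inequality.  Since n eps^2 need not tend to infinity, the constant D in that lower bound depends on n: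
  it is 1 when n eps^2 is large, and (1 + D) n eps^2 - 2 n eps^2 stays bounded.
*)

theory Submission
  imports Defs
begin

text \<open>The proof is shaped by a budget of exponents. Put s = n eps^2 and, on shell j, m = s
  j^2. The hypothesis on the shells tolerates relative prior mass e^(m/4), so the second kind of
  error needs an exponent strictly above m/4; it gets 3/10 m. Of the surplus m/20, one half pays for
  the evidence, which costs (1 + D) s <= m/40 once j >= J and 40 (1 + D) <= J^2; the other half
  makes the sum over the shells geometric. The first kind of error only competes with the at most
  e^s balls of a cover, so m/4 is enough there. The entropy condition is used at radius 2 j eps,
  which gives balls of radius j eps/18, that is 1/18 of the inner radius of the shell. The recurring
  constants 17, 17/18 and 324 = 18^2 come from this geometry. The constants are fixed in the order:
  target r, then D with a bound uniform in n, then J, then n. The divergence of M_n enters only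
  through M_n > J for this fixed J.\<close>

section \<open>Pointwise inequalities\<close>

text \<open>A damped version of b / a: adding a tenth of the other root keeps the value between 1/10
  and 10, whence the stability of its mean under small Hellinger perturbations of the law. Robust
  tests in the manner of Birge have this form. At a = b = 0 the default value of division is 0, and
  \<open>root_ratio_swap\<close> survives because 1 / 0 = 0.\<close>

definition root_ratio :: "real \<Rightarrow> real \<Rightarrow> real" where
  "root_ratio a b = (b + a / 10) / (a + b / 10)"

lemma root_ratio_nonneg: "0 \<le> a \<Longrightarrow> 0 \<le> b \<Longrightarrow> 0 \<le> root_ratio a b"
  by (simp add: root_ratio_def)

lemma root_ratio_swap: "root_ratio b a = 1 / root_ratio a b"
  by (simp add: root_ratio_def)

text \<open>For fixed a > 0, \<open>root_ratio a b\<close> equals 10 - (99/10) a / (a + b/10), which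
  is concave in b. The right-hand side comes from its tangent at b = a, with slope 9/(11 a). Being
  linear in b, it integrates to the Hellinger affinity.\<close>

lemma square_times_root_ratio_le:
  fixes a b :: real
  assumes "0 \<le> a" "0 \<le> b"
  shows "a\<^sup>2 * root_ratio a b \<le> a\<^sup>2 + 9 / 11 * (a * b - a\<^sup>2)"
proof (cases "a = 0")
  case False
  with assms have D: "0 < a + b / 10" by auto
  have "(a\<^sup>2 + 9 / 11 * (a * b - a\<^sup>2)) * (a + b / 10) - a\<^sup>2 * (b + a / 10) = 9 / 110 * a * (a - b)\<^sup>2"
    by (simp add: power2_eq_square field_simps)
  moreover have "0 \<le> 9 / 110 * a * (a - b)\<^sup>2" using assms by simp
  ultimately have "a\<^sup>2 * (b + a / 10) \<le> (a\<^sup>2 + 9 / 11 * (a * b - a\<^sup>2)) * (a + b / 10)"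
    by linarith
  with D show ?thesis by (simp add: root_ratio_def pos_divide_le_eq)
qed simp

text \<open>Here a, b, f stand for the roots of the densities of theta_0, of a centre, and of a
  parameter near the centre. Writing f = b + d, the part with b^2 falls under the tangent bound. The
  term 2 b d is kept as it is, since it integrates to minus a squared Hellinger distance. What
  remains is 2 b d (G - 1), a product of two differences, and d^2 G <= 10 d^2; hence 253/10 = 153/10
  + 10.\<close>

lemma square_times_root_ratio_perturbed_le:
  fixes a b f :: real
  assumes "0 \<le> a" "0 \<le> b"
  shows "f\<^sup>2 * root_ratio b a
    \<le> b\<^sup>2 + 9 / 11 * (a * b - b\<^sup>2) + 2 * b * (f - b) + 9 / 170 * (a - b)\<^sup>2 + 253 / 10 * (f - b)\<^sup>2"
proof (cases "a = 0 \<and> b = 0")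
  case True
  then show ?thesis by (simp add: root_ratio_def)
next
  case False
  define G where "G = root_ratio b a"
  define d where "d = f - b"
  have D: "0 < b + a / 10" using False assms by auto
  have G0: "0 \<le> G" using assms by (simp add: G_def root_ratio_def)
  have G10: "G \<le> 10" using D assms by (simp add: G_def root_ratio_def pos_divide_le_eq)
  have 1: "b\<^sup>2 * G \<le> b\<^sup>2 + 9 / 11 * (a * b - b\<^sup>2)"
    using square_times_root_ratio_le[OF assms(2,1)] by (simp add: G_def mult.commute)
  have "G - 1 = 9 / 10 * (a - b) / (b + a / 10)"
    using D by (simp add: G_def root_ratio_def field_simps)
  then have "\<bar>G - 1\<bar> = 9 / 10 * \<bar>a - b\<bar> / (b + a / 10)"
    using D by (simp only: abs_mult abs_divide)
  then have "b * \<bar>G - 1\<bar> = 9 / 10 * \<bar>a - b\<bar> * (b / (b + a / 10))"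
    by simp
  also have "\<dots> \<le> 9 / 10 * \<bar>a - b\<bar> * 1"
    using D assms by (intro mult_left_mono) (auto simp: pos_divide_le_eq)
  finally have bG: "b * \<bar>G - 1\<bar> \<le> 9 / 10 * \<bar>a - b\<bar>" by simp
  have "2 * b * d * (G - 1) \<le> \<bar>2 * b * d * (G - 1)\<bar>" by simp
  also have "\<dots> = 2 * \<bar>d\<bar> * (b * \<bar>G - 1\<bar>)" using assms by (simp add: abs_mult)
  also have "\<dots> \<le> 2 * \<bar>d\<bar> * (9 / 10 * \<bar>a - b\<bar>)" using bG by (intro mult_left_mono) auto
  also have "\<dots> \<le> 9 / 170 * (a - b)\<^sup>2 + 153 / 10 * d\<^sup>2"
  proof -
    \<comment> \<open>Weighted so that equality holds at |a - b| = 17 |d|, the ratio of distances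
      when the centre lies 17/18 of the radius away from theta_0 and the parameter 1/18 away from
      the centre.\<close>
    have "34 * (\<bar>d\<bar> * \<bar>a - b\<bar>) \<le> (a - b)\<^sup>2 + 289 * d\<^sup>2"
      using zero_le_power2[of "\<bar>a - b\<bar> - 17 * \<bar>d\<bar>"]
      by (simp only: power2_diff[of "\<bar>a - b\<bar>"] power_mult_distrib power2_abs) (simp add: mult.commute)
    then show ?thesis by linarith
  qed
  finally have 2: "2 * b * d * (G - 1) \<le> 9 / 170 * (a - b)\<^sup>2 + 153 / 10 * d\<^sup>2" .
  have 3: "d\<^sup>2 * G \<le> 10 * d\<^sup>2" using mult_left_mono[OF G10, of "d\<^sup>2"] by simp
  have "f = b + d" by (simp add: d_def)
  then have "f\<^sup>2 * G = b\<^sup>2 * G + 2 * b * d + 2 * b * d * (G - 1) + d\<^sup>2 * G"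
    by (simp add: power2_eq_square algebra_simps)
  then show ?thesis using 1 2 3 unfolding G_def[symmetric] d_def[symmetric] by linarith
qed

section \<open>Power and exponential inequalities for the evidence bound\<close>

lemma le_powr_tangent:
  fixes u k :: real
  assumes "0 \<le> u" "1 \<le> k"
  shows "u \<le> u powr k / k + (k - 1) / k"
proof (cases "u = 0")
  case False
  have "(u powr k) powr (1 / k) * 1 powr (1 - 1 / k) \<le> 1 / k * u powr k + (1 - 1 / k) * 1"
    using assms False by (intro Youngs_inequality_0) auto
  then show ?thesis using assms False by (simp add: powr_powr field_simps)
qed (use assms in auto)

text \<open>As functions of w the two sides touch at w = a. The inequality takes the place of
  Jensen's: it is linear in exp(-w) and |w|^k, so it can be averaged over parameters with
  nonnegative integrals only. If the average of |w|^k is at most a^k, the terms with a / k cancel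
  and the average of exp(-w) is at least exp(-a).\<close>

lemma exp_minus_powr_lower_bound:
  fixes a w k :: real
  assumes a: "0 < a" and k: "1 \<le> k"
  shows "exp (- a) * (1 + a / k) \<le> exp (- w) + exp (- a) * (a powr (1 - k) / k) * \<bar>w\<bar> powr k"
proof -
  have "\<bar>w\<bar> / a \<le> (\<bar>w\<bar> / a) powr k / k + (k - 1) / k"
    using a k by (intro le_powr_tangent) auto
  then have "a * (\<bar>w\<bar> / a) \<le> a * ((\<bar>w\<bar> / a) powr k / k + (k - 1) / k)"
    using a by (intro mult_left_mono) auto
  also have "\<dots> = a powr (1 - k) / k * \<bar>w\<bar> powr k + (a - a / k)"
    using a k by (simp add: powr_divide powr_diff field_simps)
  finally have "w \<le> a powr (1 - k) / k * \<bar>w\<bar> powr k + (a - a / k)" using a by simp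
  moreover have "1 + (a - w) \<le> exp (a - w)" by (rule exp_ge_add_one_self)
  ultimately have "1 + a / k \<le> exp (a - w) + a powr (1 - k) / k * \<bar>w\<bar> powr k" by linarith
  then have "exp (- a) * (1 + a / k) \<le> exp (- a) * (exp (a - w) + a powr (1 - k) / k * \<bar>w\<bar> powr k)"
    by (intro mult_left_mono) auto
  also have "\<dots> = exp (- w) + exp (- a) * (a powr (1 - k) / k) * \<bar>w\<bar> powr k"
    by (simp add: distrib_left mult_exp_exp)
  finally show ?thesis .
qed

section \<open>Moments of sums of independent variables\<close>

text \<open>The crude constant does no harm, as the bound only serves to prove integrability of the
  k-th power of a sum.\<close>

lemma abs_sum_powr_le:
  fixes y :: "'i \<Rightarrow> real"
  assumes "finite I" "1 \<le> k"
  shows "\<bar>\<Sum>i\<in>I. y i\<bar> powr k \<le> real (card I) powr k * (\<Sum>i\<in>I. \<bar>y i\<bar> powr k)"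
proof (cases "I = {}")
  case False
  define m where "m = Max ((\<lambda>i. \<bar>y i\<bar>) ` I)"
  have m: "\<bar>y i\<bar> \<le> m" if "i \<in> I" for i using that assms by (simp add: m_def)
  have "m \<in> (\<lambda>i. \<bar>y i\<bar>) ` I" using False assms unfolding m_def by (intro Max_in) auto
  then obtain i where i: "i \<in> I" "m = \<bar>y i\<bar>" by auto
  have "\<bar>\<Sum>i\<in>I. y i\<bar> \<le> (\<Sum>i\<in>I. \<bar>y i\<bar>)" by simp
  also have "\<dots> \<le> real (card I) * m" using m by (intro sum_bounded_above) auto
  finally have "\<bar>\<Sum>i\<in>I. y i\<bar> powr k \<le> (real (card I) * m) powr k"
    using assms by (intro powr_mono2) auto
  also have "\<dots> = real (card I) powr k * \<bar>y i\<bar> powr k" using i by (simp add: powr_mult)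
  also have "\<dots> \<le> real (card I) powr k * (\<Sum>i\<in>I. \<bar>y i\<bar> powr k)"
    using assms i by (intro mult_left_mono member_le_sum) auto
  finally show ?thesis .
qed simp

text \<open>Since \<open>mz_constant\<close> speaks of measures over
  \<open>nat \<Rightarrow> real\<close>, the joint law of the variables f_i(X_i) is pushed forward
  to that type, where the coordinates play the role of the Y_i. The passage from the mean to the sum
  turns n^(-k/2) into n^k n^(-k/2) = n^(k/2).\<close>

lemma mz_constant_sum_bound:
  fixes P :: "nat \<Rightarrow> 'x measure" and f :: "nat \<Rightarrow> 'x \<Rightarrow> real"
  assumes C: "mz_constant k C" and k: "1 \<le> k" and n: "1 \<le> n"
    and P: "\<And>i. prob_space (P i)"
    and f[measurable]: "\<And>i. i < n \<Longrightarrow> f i \<in> borel_measurable (P i)"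
    and int1: "\<And>i. i < n \<Longrightarrow> integrable (P i) (f i)"
    and int: "\<And>i. i < n \<Longrightarrow> integrable (P i) (\<lambda>x. \<bar>f i x\<bar> powr k)"
    and mean: "\<And>i. i < n \<Longrightarrow> (LINT x|P i. f i x) = 0"
  shows "(\<integral>\<^sup>+X. ennreal (\<bar>\<Sum>i<n. f i (X i)\<bar> powr k) \<partial>PiM {..<n} P)
    \<le> ennreal (real n powr (k / 2) * (C * ((\<Sum>i<n. LINT x|P i. \<bar>f i x\<bar> powr k) / real n)))"
proof -
  define Q where "Q = PiM {..<n} P"
  define N where "N = (PiM {..<n} (\<lambda>_. borel) :: (nat \<Rightarrow> real) measure)"
  define g where "g = (\<lambda>X. \<lambda>i\<in>{..<n}. f i (X i))"
  define M where "M = distr Q N g"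
  interpret P: product_prob_space P UNIV by (intro product_prob_spaceI P)
  interpret Q: prob_space Q unfolding Q_def by (intro prob_space_PiM P)
  have comp: "(\<lambda>X. f i (X i)) \<in> borel_measurable Q" if "i < n" for i
    using that measurable_compose[OF measurable_component_singleton[of i "{..<n}" P] f[of i]]
    unfolding Q_def by auto
  have g[measurable]: "g \<in> measurable Q N"
    unfolding g_def N_def by (intro measurable_restrict) (use comp in auto)
  interpret M: prob_space M unfolding M_def by (intro Q.prob_space_distr g)
  have coord: "(\<lambda>\<omega>. \<omega> i) \<in> borel_measurable N" if "i < n" for i
    using that unfolding N_def by (auto intro!: measurable_component_singleton)
  have int_coord: "integral\<^sup>L M (\<lambda>\<omega>. h (\<omega> i)) = (LINT x|P i. h (f i x))"
    "integrable (P i) (\<lambda>x. h (f i x)) \<Longrightarrow> integrable M (\<lambda>\<omega>. h (\<omega> i))"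
    if "i < n" and [measurable]: "h \<in> borel_measurable borel" for i and h :: "real \<Rightarrow> real"
  proof -
    have [measurable]: "(\<lambda>\<omega>. \<omega> i) \<in> borel_measurable N" using coord that by simp
    have [measurable]: "f i \<in> borel_measurable (P i)" using that by simp
    have D: "P i = distr Q (P i) (\<lambda>\<omega>. \<omega> i)"
      using that unfolding Q_def by (intro distr_PiM_component[symmetric] P) auto
    have [measurable]: "(\<lambda>\<omega>. \<omega> i) \<in> measurable Q (P i)"
      using that unfolding Q_def by (auto intro!: measurable_component_singleton)
    have "integral\<^sup>L M (\<lambda>\<omega>. h (\<omega> i)) = (LINT X|Q. h (f i (X i)))"
      unfolding M_def using that by (subst integral_distr[OF g]) (auto simp: g_def)
    also have "\<dots> = (LINT x|distr Q (P i) (\<lambda>\<omega>. \<omega> i). h (f i x))"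
      by (subst integral_distr) auto
    finally show "integral\<^sup>L M (\<lambda>\<omega>. h (\<omega> i)) = (LINT x|P i. h (f i x))" unfolding D[symmetric] .
    assume "integrable (P i) (\<lambda>x. h (f i x))"
    then have "integrable (distr Q (P i) (\<lambda>\<omega>. \<omega> i)) (\<lambda>x. h (f i x))" unfolding D[symmetric] .
    then have "integrable Q (\<lambda>X. h (f i (X i)))" by (subst (asm) integrable_distr_eq) auto
    then show "integrable M (\<lambda>\<omega>. h (\<omega> i))"
      unfolding M_def using that by (subst integrable_distr_eq[OF g]) (auto simp: g_def)
  qed
  \<comment> \<open>Independence is the identity of the joint law with the product of the marginals.
    It is immediate for the coordinates of the product measure \<open>Q\<close>, passes to f_i(X_i)
    by composition, and is then carried along \<open>g\<close>.\<close>
  have indep: "M.indep_vars (\<lambda>_. borel) (\<lambda>i \<omega>. \<omega> i) {..<n}"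
  proof -
    have "Q.indep_vars P (\<lambda>i X. X i) {..<n}"
    proof (subst Q.indep_vars_iff_distr_eq_PiM')
      have "distr Q (PiM {..<n} P) (\<lambda>x. \<lambda>i\<in>{..<n}. x i) = distr Q Q (\<lambda>x. x)"
        unfolding Q_def by (intro distr_cong) (auto simp: space_PiM PiE_def extensional_def fun_eq_iff)
      also have "\<dots> = PiM {..<n} (\<lambda>i. distr Q (P i) (\<lambda>x. x i))"
        unfolding Q_def distr_id2[OF refl]
        by (intro PiM_cong distr_PiM_component[symmetric] P refl) auto
      finally show "distr Q (PiM {..<n} P) (\<lambda>x. \<lambda>i\<in>{..<n}. x i) = PiM {..<n} (\<lambda>i. distr Q (P i) (\<lambda>x. x i))" .
    qed (use n in \<open>auto simp: Q_def lessThan_empty_iff\<close>)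
    then have iQ: "Q.indep_vars (\<lambda>_. borel) (\<lambda>i X. f i (X i)) {..<n}"
      by (rule Q.indep_vars_compose2) auto
    have Qd: "distr Q N (\<lambda>X. \<lambda>i\<in>{..<n}. f i (X i)) = PiM {..<n} (\<lambda>i. distr Q borel (\<lambda>X. f i (X i)))"
      using iQ comp n unfolding N_def by (subst (asm) Q.indep_vars_iff_distr_eq_PiM') (auto simp: lessThan_empty_iff)
    show ?thesis
    proof (subst M.indep_vars_iff_distr_eq_PiM')
      have sM: "space M \<subseteq> extensional {..<n}"
        by (auto simp: M_def N_def space_PiM PiE_def)
      have "distr M (PiM {..<n} (\<lambda>_. borel)) (\<lambda>x. \<lambda>i\<in>{..<n}. x i) = distr M M (\<lambda>x. x)"
        using sM by (intro distr_cong) (auto simp: M_def N_def extensional_def fun_eq_iff)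
      also have "\<dots> = PiM {..<n} (\<lambda>i. distr Q borel (\<lambda>X. f i (X i)))"
        unfolding distr_id2[OF refl] using Qd by (simp add: M_def g_def)
      also have "\<dots> = PiM {..<n} (\<lambda>i. distr M borel (\<lambda>x. x i))"
      proof (intro PiM_cong refl)
        fix i assume "i \<in> {..<n}"
        then show "distr Q borel (\<lambda>X. f i (X i)) = distr M borel (\<lambda>x. x i)"
          unfolding M_def using coord by (subst distr_distr[OF _ g]) (auto simp: comp_def g_def)
      qed
      finally show "distr M (PiM {..<n} (\<lambda>_. borel)) (\<lambda>x. \<lambda>i\<in>{..<n}. x i) = PiM {..<n} (\<lambda>i. distr M borel (\<lambda>x. x i))" .
    qed (use n coord in \<open>auto simp: M_def lessThan_empty_iff\<close>)
  qed
  have intM: "integrable M (\<lambda>\<omega>. \<bar>\<omega> i\<bar> powr k)" if "i < n" for i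
    using that int by (intro int_coord(2)[of i "\<lambda>y. \<bar>y\<bar> powr k"]) auto
  have intM1: "integrable M (\<lambda>\<omega>. \<omega> i)" if "i < n" for i
    using that int1 int_coord(2)[of i "\<lambda>y. y"] by auto
  have meanM: "(LINT \<omega>|M. (\<Sum>i<n. \<omega> i) / real n) = 0"
    using mean intM1 int_coord(1)[of _ "\<lambda>y. y"] by (simp add: Bochner_Integration.integral_sum)
  have "(LINT \<omega>|M. \<bar>(\<Sum>i<n. \<omega> i) / real n\<bar> powr k)
      \<le> C * real n powr (- (k / 2)) * ((\<Sum>i<n. LINT \<omega>|M. \<bar>\<omega> i\<bar> powr k) / real n)"
  proof -
    have "\<forall>(M :: (nat \<Rightarrow> real) measure) (Y :: nat \<Rightarrow> (nat \<Rightarrow> real) \<Rightarrow> real).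
        prob_space M \<longrightarrow>
        prob_space.indep_vars M (\<lambda>_. borel) Y {..<n} \<longrightarrow>
        (\<forall>i<n. integrable M (\<lambda>\<omega>. \<bar>Y i \<omega>\<bar> powr k)) \<longrightarrow>
        (let Ybar = (\<lambda>\<omega>. (\<Sum>i<n. Y i \<omega>) / real n) in
          (LINT \<omega>|M. \<bar>Ybar \<omega> - (LINT \<omega>'|M. Ybar \<omega>')\<bar> powr k)
            \<le> C * real n powr (- (k / 2)) * ((\<Sum>i<n. LINT \<omega>|M. \<bar>Y i \<omega>\<bar> powr k) / real n))"
      using C n unfolding mz_constant_def by blast
    from this[rule_format, OF M.prob_space_axioms indep] intM meanM n show ?thesis
      by (auto simp: Let_def)
  qed
  also have "(\<Sum>i<n. LINT \<omega>|M. \<bar>\<omega> i\<bar> powr k) = (\<Sum>i<n. LINT x|P i. \<bar>f i x\<bar> powr k)"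
    by (intro sum.cong refl int_coord(1)[of _ "\<lambda>y. \<bar>y\<bar> powr k"]) auto
  finally have 1: "(LINT \<omega>|M. \<bar>(\<Sum>i<n. \<omega> i) / real n\<bar> powr k)
      \<le> C * real n powr (- (k / 2)) * ((\<Sum>i<n. LINT x|P i. \<bar>f i x\<bar> powr k) / real n)" .
  have sumN[measurable]: "(\<lambda>\<omega>. \<Sum>i<n. \<omega> i) \<in> borel_measurable N"
    using coord by (intro borel_measurable_sum) auto
  \<comment> \<open>The Bochner integral of a non-integrable function is 0 by default, so without
    this the moment inequality would give no bound on the nonnegative integral.\<close>
  have intS: "integrable M (\<lambda>\<omega>. \<bar>\<Sum>i<n. \<omega> i\<bar> powr k)"
  proof (rule Bochner_Integration.integrable_bound)
    show "integrable M (\<lambda>\<omega>. real n powr k * (\<Sum>i<n. \<bar>\<omega> i\<bar> powr k))"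
      using intM by (intro integrable_mult_right Bochner_Integration.integrable_sum) auto
    show "AE \<omega> in M. norm (\<bar>\<Sum>i<n. \<omega> i\<bar> powr k) \<le> norm (real n powr k * (\<Sum>i<n. \<bar>\<omega> i\<bar> powr k))"
      using abs_sum_powr_le[of "{..<n}" k] k by (intro AE_I2) (auto simp: sum_nonneg)
  qed (auto simp: M_def)
  have "(LINT \<omega>|M. \<bar>\<Sum>i<n. \<omega> i\<bar> powr k)
      = real n powr k * (LINT \<omega>|M. \<bar>(\<Sum>i<n. \<omega> i) / real n\<bar> powr k)"
    using n by (simp add: abs_divide powr_divide)
  also have "\<dots> \<le> real n powr k * (C * real n powr (- (k / 2)) * ((\<Sum>i<n. LINT x|P i. \<bar>f i x\<bar> powr k) / real n))"
    using 1 by (intro mult_left_mono) auto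
  also have "\<dots> = (real n powr k * real n powr (- (k / 2))) * (C * ((\<Sum>i<n. LINT x|P i. \<bar>f i x\<bar> powr k) / real n))"
    by (simp add: mult_ac)
  also have "real n powr k * real n powr (- (k / 2)) = real n powr (k / 2)"
    by (simp add: powr_add[symmetric])
  finally have 2: "(LINT \<omega>|M. \<bar>\<Sum>i<n. \<omega> i\<bar> powr k)
     \<le> real n powr (k / 2) * (C * ((\<Sum>i<n. LINT x|P i. \<bar>f i x\<bar> powr k) / real n))" .
  have "(\<integral>\<^sup>+X. ennreal (\<bar>\<Sum>i<n. f i (X i)\<bar> powr k) \<partial>Q) = (\<integral>\<^sup>+\<omega>. ennreal (\<bar>\<Sum>i<n. \<omega> i\<bar> powr k) \<partial>M)"
    unfolding M_def by (subst nn_integral_distr[OF g]) (auto simp: g_def)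
  also have "\<dots> = ennreal (LINT \<omega>|M. \<bar>\<Sum>i<n. \<omega> i\<bar> powr k)"
    using intS by (intro nn_integral_eq_integral) auto
  also have "\<dots> \<le> ennreal (real n powr (k / 2) * (C * ((\<Sum>i<n. LINT x|P i. \<bar>f i x\<bar> powr k) / real n)))"
    using 2 by (intro ennreal_leI)
  finally show ?thesis unfolding Q_def .
qed

section \<open>Hellinger distance and likelihood ratios\<close>

locale product_model =
  fixes \<mu> :: "nat \<Rightarrow> 'x measure" and T :: "'p measure"
    and p :: "'p \<Rightarrow> nat \<Rightarrow> 'x \<Rightarrow> real" and \<theta>\<^sub>0 :: 'p
  assumes sigma_finite: "\<And>i. sigma_finite_measure (\<mu> i)"
    and dens_meas: "\<And>i. (\<lambda>(\<theta>, x). p \<theta> i x) \<in> borel_measurable (T \<Otimes>\<^sub>M \<mu> i)"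
    and dens_nonneg: "\<And>\<theta> i x. \<theta> \<in> space T \<Longrightarrow> x \<in> space (\<mu> i) \<Longrightarrow> 0 \<le> p \<theta> i x"
    and dens_prob: "\<And>\<theta> i. \<theta> \<in> space T \<Longrightarrow> prob_space (law \<mu> p \<theta> i)"
    and true_param: "\<theta>\<^sub>0 \<in> space T"
begin

lemma dens_measurable[measurable]: "\<theta> \<in> space T \<Longrightarrow> p \<theta> i \<in> borel_measurable (\<mu> i)"
  using measurable_compose_Pair1[OF _ dens_meas, of \<theta> i] by simp

lemma dens0_measurable[measurable]: "p \<theta>\<^sub>0 i \<in> borel_measurable (\<mu> i)"
  using true_param by simp

lemma space_law[simp]: "space (law \<mu> p \<theta> i) = space (\<mu> i)"
  and sets_law[simp, measurable_cong]: "sets (law \<mu> p \<theta> i) = sets (\<mu> i)"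
  by (auto simp: law_def)

lemma nn_integral_law:
  "\<theta> \<in> space T \<Longrightarrow> h \<in> borel_measurable (\<mu> i) \<Longrightarrow>
    (\<integral>\<^sup>+x. h x \<partial>law \<mu> p \<theta> i) = (\<integral>\<^sup>+x. ennreal (p \<theta> i x) * h x \<partial>\<mu> i)"
  unfolding law_def by (intro nn_integral_density) auto

lemma nn_integral_dens: "\<theta> \<in> space T \<Longrightarrow> (\<integral>\<^sup>+x. ennreal (p \<theta> i x) \<partial>\<mu> i) = 1"
  using prob_space.emeasure_space_1[OF dens_prob, of \<theta> i] nn_integral_law[of \<theta> "\<lambda>_. 1" i]
  by simp

lemma integrable_dens: "\<theta> \<in> space T \<Longrightarrow> integrable (\<mu> i) (p \<theta> i)"
  using dens_nonneg nn_integral_dens by (intro integrableI_nonneg) auto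

lemma integral_dens: "\<theta> \<in> space T \<Longrightarrow> (LINT x|\<mu> i. p \<theta> i x) = 1"
  using dens_nonneg nn_integral_dens by (subst integral_eq_nn_integral) auto

section \<open>Hellinger affinity and distance\<close>

lemma integrable_sqrt_dens_mult:
  assumes [simp]: "\<theta> \<in> space T" "\<theta>' \<in> space T"
  shows "integrable (\<mu> i) (\<lambda>x. sqrt (p \<theta> i x) * sqrt (p \<theta>' i x))"
proof (rule Bochner_Integration.integrable_bound)
  show "integrable (\<mu> i) (\<lambda>x. p \<theta> i x + p \<theta>' i x)"
    by (intro Bochner_Integration.integrable_add integrable_dens) auto
  show "AE x in \<mu> i. norm (sqrt (p \<theta> i x) * sqrt (p \<theta>' i x)) \<le> norm (p \<theta> i x + p \<theta>' i x)"
  proof (rule AE_I2)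
    fix x assume x: "x \<in> space (\<mu> i)"
    note nn = dens_nonneg[OF assms(1) x] dens_nonneg[OF assms(2) x]
    have "2 * (sqrt (p \<theta> i x) * sqrt (p \<theta>' i x)) \<le> p \<theta> i x + p \<theta>' i x"
      using zero_le_power2[of "sqrt (p \<theta> i x) - sqrt (p \<theta>' i x)"] nn by (simp add: power2_diff)
    moreover have "0 \<le> sqrt (p \<theta> i x) * sqrt (p \<theta>' i x)" using nn by simp
    ultimately show "norm (sqrt (p \<theta> i x) * sqrt (p \<theta>' i x)) \<le> norm (p \<theta> i x + p \<theta>' i x)"
      using nn by simp
  qed
qed auto

definition hell2 :: "nat \<Rightarrow> 'p \<Rightarrow> 'p \<Rightarrow> real" where
  "hell2 i \<theta> \<theta>' = (LINT x|\<mu> i. (sqrt (p \<theta> i x) - sqrt (p \<theta>' i x))\<^sup>2)"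

lemma sqrt_diff_power2:
  assumes "\<theta> \<in> space T" "\<theta>' \<in> space T" "x \<in> space (\<mu> i)"
  shows "(sqrt (p \<theta> i x) - sqrt (p \<theta>' i x))\<^sup>2 = p \<theta> i x + p \<theta>' i x - 2 * (sqrt (p \<theta> i x) * sqrt (p \<theta>' i x))"
  using dens_nonneg assms by (simp add: power2_diff)

lemma integrable_hell2:
  assumes [simp]: "\<theta> \<in> space T" "\<theta>' \<in> space T"
  shows "integrable (\<mu> i) (\<lambda>x. (sqrt (p \<theta> i x) - sqrt (p \<theta>' i x))\<^sup>2)"
proof (subst Bochner_Integration.integrable_cong[OF refl sqrt_diff_power2])
  show "integrable (\<mu> i) (\<lambda>x. p \<theta> i x + p \<theta>' i x - 2 * (sqrt (p \<theta> i x) * sqrt (p \<theta>' i x)))"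
    by (intro Bochner_Integration.integrable_add Bochner_Integration.integrable_diff integrable_dens
        integrable_mult_right integrable_sqrt_dens_mult) auto
qed auto

lemma affinity_eq:
  assumes [simp]: "\<theta> \<in> space T" "\<theta>' \<in> space T"
  shows "(LINT x|\<mu> i. sqrt (p \<theta> i x) * sqrt (p \<theta>' i x)) = 1 - hell2 i \<theta> \<theta>' / 2"
proof -
  have "hell2 i \<theta> \<theta>' = (LINT x|\<mu> i. p \<theta> i x + p \<theta>' i x - 2 * (sqrt (p \<theta> i x) * sqrt (p \<theta>' i x)))"
    unfolding hell2_def by (intro Bochner_Integration.integral_cong refl sqrt_diff_power2) auto
  also have "\<dots> = 2 - 2 * (LINT x|\<mu> i. sqrt (p \<theta> i x) * sqrt (p \<theta>' i x))"
    using integrable_dens integrable_sqrt_dens_mult integral_dens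
    by (subst Bochner_Integration.integral_diff)
       (auto intro!: Bochner_Integration.integrable_add simp: Bochner_Integration.integral_add)
  finally show ?thesis by linarith
qed

lemma hell2_nonneg: "0 \<le> hell2 i \<theta> \<theta>'"
  unfolding hell2_def by simp

lemma hell2_commute: "hell2 i \<theta> \<theta>' = hell2 i \<theta>' \<theta>"
  unfolding hell2_def by (simp add: power2_commute)

text \<open>For n >= 1 this is n times the squared distance d_n. Exponents of product statistics add
  up over the components, so the tests are measured in this unit.\<close>

definition hell2_sum :: "nat \<Rightarrow> 'p \<Rightarrow> 'p \<Rightarrow> real" where
  "hell2_sum n \<theta> \<theta>' = (\<Sum>i<n. hell2 i \<theta> \<theta>')"

lemma hell2_sum_nonneg: "0 \<le> hell2_sum n \<theta> \<theta>'"
  unfolding hell2_sum_def by (intro sum_nonneg hell2_nonneg)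

lemma hellinger_avg_nonneg: "0 \<le> hellinger_avg \<mu> p n \<theta> \<theta>'"
  unfolding hellinger_avg_def by (auto intro!: divide_nonneg_nonneg sum_nonneg)

lemma hell2_sum_eq: "1 \<le> n \<Longrightarrow> hell2_sum n \<theta> \<theta>' = real n * (hellinger_avg \<mu> p n \<theta> \<theta>')\<^sup>2"
  using hell2_sum_nonneg[of n \<theta> \<theta>']
  by (simp add: hell2_sum_def hell2_def hellinger_avg_def)

text \<open>With the weight 1/17 this is sharp when the distance from \<open>\<theta>\<close> to \<open>c\<close> is 1/18 of that to \<open>\<theta>'\<close>.\<close>

lemma hell2_sum_weighted_triangle:
  assumes [simp]: "\<theta> \<in> space T" "\<theta>' \<in> space T" "c \<in> space T"
  shows "hell2_sum n \<theta> \<theta>' \<le> 18 / 17 * hell2_sum n c \<theta>' + 18 * hell2_sum n \<theta> c"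
proof -
  have "hell2 i \<theta> \<theta>' \<le> 18 / 17 * hell2 i c \<theta>' + 18 * hell2 i \<theta> c" for i
  proof -
    have ineq: "(a - d)\<^sup>2 \<le> 18 / 17 * (e - d)\<^sup>2 + 18 * (a - e)\<^sup>2" for a d e :: real
    proof -
      have "18 / 17 * (e - d)\<^sup>2 + 18 * (a - e)\<^sup>2 - (a - d)\<^sup>2 = ((e - d) - 17 * (a - e))\<^sup>2 / 17"
        by (simp add: power2_eq_square field_simps)
      moreover have "0 \<le> ((e - d) - 17 * (a - e))\<^sup>2 / 17" by simp
      ultimately show ?thesis by linarith
    qed
    have "hell2 i \<theta> \<theta>' \<le> (LINT x|\<mu> i. 18 / 17 * (sqrt (p c i x) - sqrt (p \<theta>' i x))\<^sup>2
        + 18 * (sqrt (p \<theta> i x) - sqrt (p c i x))\<^sup>2)"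
      unfolding hell2_def using ineq integrable_hell2
      by (intro integral_mono Bochner_Integration.integrable_add integrable_mult_right) auto
    also have "\<dots> = 18 / 17 * hell2 i c \<theta>' + 18 * hell2 i \<theta> c"
      unfolding hell2_def using integrable_hell2
      by (subst Bochner_Integration.integral_add) auto
    finally show ?thesis .
  qed
  then have "hell2_sum n \<theta> \<theta>' \<le> (\<Sum>i<n. 18 / 17 * hell2 i c \<theta>' + 18 * hell2 i \<theta> c)"
    unfolding hell2_sum_def by (intro sum_mono)
  then show ?thesis by (simp only: hell2_sum_def sum.distrib sum_distrib_left)
qed

lemma hellinger_measurable:
  "(\<lambda>\<theta>. hellinger_avg \<mu> p n \<theta> \<theta>\<^sub>0) \<in> borel_measurable T"
proof -
  have "(\<lambda>\<theta>. LINT x|\<mu> i. (sqrt (p \<theta> i x) - sqrt (p \<theta>\<^sub>0 i x))\<^sup>2) \<in> borel_measurable T" for i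
  proof (rule sigma_finite_measure.borel_measurable_lebesgue_integral[OF sigma_finite])
    show "(\<lambda>(\<theta>, x). (sqrt (p \<theta> i x) - sqrt (p \<theta>\<^sub>0 i x))\<^sup>2) \<in> borel_measurable (T \<Otimes>\<^sub>M \<mu> i)"
      using dens_meas[of i] by measurable
  qed
  then show ?thesis unfolding hellinger_avg_def by measurable
qed

section \<open>The law of the observation under theta_0 and product statistics\<close>

abbreviation P0 :: "nat \<Rightarrow> (nat \<Rightarrow> 'x) measure" where
  "P0 n \<equiv> joint_law \<mu> p n \<theta>\<^sub>0"

lemma prob_space_P0: "prob_space (P0 n)"
  unfolding joint_law_def by (intro prob_space_PiM dens_prob true_param)

lemma sets_P0[measurable_cong]: "sets (P0 n) = sets (PiM {..<n} \<mu>)"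
  unfolding joint_law_def by (intro sets_PiM_cong) auto

lemma space_P0: "space (P0 n) = space (PiM {..<n} \<mu>)"
  using sets_P0 by (rule sets_eq_imp_space_eq)

lemma coord_space: "X \<in> space (P0 n) \<Longrightarrow> i < n \<Longrightarrow> X i \<in> space (\<mu> i)"
  by (auto simp: space_P0 space_PiM)

lemma coord_measurable: "i < n \<Longrightarrow> (\<lambda>X. X i) \<in> measurable (P0 n) (\<mu> i)"
  using measurable_component_singleton[of i "{..<n}" \<mu>]
  by (simp add: measurable_cong_sets[OF sets_P0 refl])

lemma coord_compose_measurable:
  "i < n \<Longrightarrow> f \<in> measurable (\<mu> i) N \<Longrightarrow> (\<lambda>X. f (X i)) \<in> measurable (P0 n) N"
  using measurable_compose[OF coord_measurable] by blast

lemma nn_integral_P0_prod: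
  assumes f: "\<And>i. i < n \<Longrightarrow> f i \<in> borel_measurable (\<mu> i)"
    and nn: "\<And>i x. i < n \<Longrightarrow> x \<in> space (\<mu> i) \<Longrightarrow> 0 \<le> f i x"
  shows "(\<integral>\<^sup>+X. ennreal (\<Prod>i<n. f i (X i)) \<partial>P0 n)
    = (\<Prod>i<n. \<integral>\<^sup>+x. ennreal (p \<theta>\<^sub>0 i x * f i x) \<partial>\<mu> i)"
proof -
  interpret product_sigma_finite "law \<mu> p \<theta>\<^sub>0"
    by (intro product_sigma_finite.intro prob_space_imp_sigma_finite dens_prob true_param)
  have "(\<integral>\<^sup>+X. ennreal (\<Prod>i<n. f i (X i)) \<partial>P0 n) = (\<integral>\<^sup>+X. (\<Prod>i<n. ennreal (f i (X i))) \<partial>P0 n)"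
    by (intro nn_integral_cong prod_ennreal[symmetric]) (auto intro: nn coord_space)
  also have "\<dots> = (\<Prod>i<n. \<integral>\<^sup>+x. ennreal (f i x) \<partial>law \<mu> p \<theta>\<^sub>0 i)"
    unfolding joint_law_def using f by (intro product_nn_integral_prod) auto
  also have "\<dots> = (\<Prod>i<n. \<integral>\<^sup>+x. ennreal (p \<theta>\<^sub>0 i x * f i x) \<partial>\<mu> i)"
    using f nn dens_nonneg[OF true_param] true_param
    by (intro prod.cong refl) (auto simp: nn_integral_law ennreal_mult intro!: nn_integral_cong)
  finally show ?thesis .
qed

lemma AE_P0_dens_pos: "AE X in P0 n. \<forall>i<n. 0 < p \<theta>\<^sub>0 i (X i)"
proof -
  have "AE X in P0 n. 0 < p \<theta>\<^sub>0 i (X i)" if "i < n" for i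
    unfolding joint_law_def
  proof (rule AE_PiM_component)
    have "AE x in \<mu> i. 0 < ennreal (p \<theta>\<^sub>0 i x) \<longrightarrow> 0 < p \<theta>\<^sub>0 i x" by simp
    then show "AE x in law \<mu> p \<theta>\<^sub>0 i. 0 < p \<theta>\<^sub>0 i x"
      unfolding law_def by (subst AE_density) auto
  qed (use that dens_prob true_param in auto)
  then have "AE X in P0 n. \<forall>i\<in>{..<n}. 0 < p \<theta>\<^sub>0 i (X i)"
    by (intro AE_finite_allI) auto
  then show ?thesis by (simp add: Ball_def)
qed

text \<open>A factor with vanishing denominator is 0 by default. Thus the part of the law of theta
  that is singular to that of theta_0 is lost, and means under theta_0 are bounded by 1 instead of
  equal to 1; this suffices for upper bounds on the numerator of the posterior. By
  \<open>AE_P0_dens_pos\<close> the default value has probability 0.\<close>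

definition lik_ratio :: "nat \<Rightarrow> 'p \<Rightarrow> (nat \<Rightarrow> 'x) \<Rightarrow> real" where
  "lik_ratio n \<theta> X = (\<Prod>i<n. p \<theta> i (X i) / p \<theta>\<^sub>0 i (X i))"

lemma lik_ratio_nonneg: "\<theta> \<in> space T \<Longrightarrow> X \<in> space (P0 n) \<Longrightarrow> 0 \<le> lik_ratio n \<theta> X"
  unfolding lik_ratio_def using coord_space dens_nonneg true_param
  by (intro prod_nonneg divide_nonneg_nonneg) auto

text \<open>The statistic for testing theta_0 against a ball around c; small values speak for
  theta_0.\<close>

definition lr_stat :: "nat \<Rightarrow> 'p \<Rightarrow> (nat \<Rightarrow> 'x) \<Rightarrow> real" where
  "lr_stat n c X = (\<Prod>i<n. root_ratio (sqrt (p \<theta>\<^sub>0 i (X i))) (sqrt (p c i (X i))))"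

lemma root_ratio_measurable:
  "\<theta> \<in> space T \<Longrightarrow> \<theta>' \<in> space T \<Longrightarrow>
    (\<lambda>x. root_ratio (sqrt (p \<theta> i x)) (sqrt (p \<theta>' i x))) \<in> borel_measurable (\<mu> i)"
  unfolding root_ratio_def by measurable

lemma lr_stat_measurable: "c \<in> space T \<Longrightarrow> lr_stat n c \<in> borel_measurable (P0 n)"
  unfolding lr_stat_def[abs_def] using true_param
  by (intro borel_measurable_prod coord_compose_measurable root_ratio_measurable) auto

text \<open>The tangent bound integrates to 1 - (9/11) h^2/2 in each component, because the affinity
  is 1 - h^2/2; then 1 - x <= exp(-x) is applied factor by factor.\<close>

lemma lr_stat_mean:
  assumes c[simp]: "c \<in> space T"
  shows "(\<integral>\<^sup>+X. ennreal (lr_stat n c X) \<partial>P0 n) \<le> ennreal (exp (- 9 / 22 * hell2_sum n c \<theta>\<^sub>0))"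
proof -
  note [simp] = true_param
  have 1: "(\<integral>\<^sup>+x. ennreal (p \<theta>\<^sub>0 i x * root_ratio (sqrt (p \<theta>\<^sub>0 i x)) (sqrt (p c i x))) \<partial>\<mu> i)
      \<le> ennreal (exp (- 9 / 22 * hell2 i c \<theta>\<^sub>0))" for i
  proof -
    let ?g = "\<lambda>x. 2 / 11 * p \<theta>\<^sub>0 i x + 9 / 11 * (sqrt (p c i x) * sqrt (p \<theta>\<^sub>0 i x))"
    have int: "integrable (\<mu> i) ?g"
      using integrable_dens integrable_sqrt_dens_mult by auto
    have "(\<integral>\<^sup>+x. ennreal (p \<theta>\<^sub>0 i x * root_ratio (sqrt (p \<theta>\<^sub>0 i x)) (sqrt (p c i x))) \<partial>\<mu> i)
        \<le> (\<integral>\<^sup>+x. ennreal (?g x) \<partial>\<mu> i)"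
    proof (intro nn_integral_mono ennreal_leI)
      fix x assume "x \<in> space (\<mu> i)"
      then have "0 \<le> p \<theta>\<^sub>0 i x" "0 \<le> p c i x" using dens_nonneg by auto
      then show "p \<theta>\<^sub>0 i x * root_ratio (sqrt (p \<theta>\<^sub>0 i x)) (sqrt (p c i x)) \<le> ?g x"
        using square_times_root_ratio_le[of "sqrt (p \<theta>\<^sub>0 i x)" "sqrt (p c i x)"]
        by (simp add: field_simps)
    qed
    also have "\<dots> = ennreal (LINT x|\<mu> i. ?g x)"
      using int dens_nonneg by (intro nn_integral_eq_integral) auto
    also have "(LINT x|\<mu> i. ?g x) = 1 - 9 / 22 * hell2 i c \<theta>\<^sub>0"
    proof -
      have "(LINT x|\<mu> i. ?g x) = 2 / 11 * (LINT x|\<mu> i. p \<theta>\<^sub>0 i x)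
        + 9 / 11 * (LINT x|\<mu> i. sqrt (p c i x) * sqrt (p \<theta>\<^sub>0 i x))"
        using integrable_dens integrable_sqrt_dens_mult by (subst Bochner_Integration.integral_add) auto
      also have "\<dots> = 1 - 9 / 22 * hell2 i c \<theta>\<^sub>0"
        by (simp add: integral_dens affinity_eq hell2_commute[of i \<theta>\<^sub>0] field_simps)
      finally show ?thesis .
    qed
    also have "ennreal (1 - 9 / 22 * hell2 i c \<theta>\<^sub>0) \<le> ennreal (exp (- 9 / 22 * hell2 i c \<theta>\<^sub>0))"
      using exp_ge_add_one_self[of "- 9 / 22 * hell2 i c \<theta>\<^sub>0"] by (intro ennreal_leI) simp
    finally show ?thesis .
  qed
  have "(\<integral>\<^sup>+X. ennreal (lr_stat n c X) \<partial>P0 n)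
    = (\<Prod>i<n. \<integral>\<^sup>+x. ennreal (p \<theta>\<^sub>0 i x * root_ratio (sqrt (p \<theta>\<^sub>0 i x)) (sqrt (p c i x))) \<partial>\<mu> i)"
    unfolding lr_stat_def using dens_nonneg
    by (intro nn_integral_P0_prod root_ratio_measurable root_ratio_nonneg) auto
  also have "\<dots> \<le> (\<Prod>i<n. ennreal (exp (- 9 / 22 * hell2 i c \<theta>\<^sub>0)))"
    using 1 by (intro prod_mono_ennreal) auto
  also have "\<dots> = ennreal (exp (- 9 / 22 * hell2_sum n c \<theta>\<^sub>0))"
    by (simp add: prod_ennreal exp_sum[symmetric] hell2_sum_def sum_distrib_left sum_negf
        del: times_divide_eq_left)
  finally show ?thesis .
qed

text \<open>Weighting by the likelihood ratio changes the law from theta_0 to theta, up to lost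
  singular mass. The coefficient 333/935 is 9/22 from the tangent bound less 9/170 from the cross
  term. The coefficient 243/10 is 253/10 less 1, since the integral of 2 b (f - b) is minus the
  squared Hellinger distance from theta to c.\<close>

lemma lr_stat_inverse_mean:
  assumes c[simp]: "c \<in> space T" and th[simp]: "\<theta> \<in> space T"
  shows "(\<integral>\<^sup>+X. ennreal (lik_ratio n \<theta> X / lr_stat n c X) \<partial>P0 n)
    \<le> ennreal (exp (- (333 / 935) * hell2_sum n c \<theta>\<^sub>0 + 243 / 10 * hell2_sum n \<theta> c))"
proof -
  note [simp] = true_param
  let ?G = "\<lambda>i x. root_ratio (sqrt (p c i x)) (sqrt (p \<theta>\<^sub>0 i x))"
  let ?e = "\<lambda>i. - (333 / 935) * hell2 i c \<theta>\<^sub>0 + 243 / 10 * hell2 i \<theta> c"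
  have 1: "(\<integral>\<^sup>+x. ennreal (p \<theta>\<^sub>0 i x * (p \<theta> i x / p \<theta>\<^sub>0 i x * ?G i x)) \<partial>\<mu> i) \<le> ennreal (exp (?e i))" for i
  proof -
    let ?a = "\<lambda>x. sqrt (p \<theta>\<^sub>0 i x)" and ?b = "\<lambda>x. sqrt (p c i x)" and ?f = "\<lambda>x. sqrt (p \<theta> i x)"
    let ?g = "\<lambda>x. - 20 / 11 * p c i x + 9 / 11 * (?b x * ?a x) + 2 * (?f x * ?b x)
        + 9 / 170 * (?b x - ?a x)\<^sup>2 + 253 / 10 * (?f x - ?b x)\<^sup>2"
    have int: "integrable (\<mu> i) ?g"
      using integrable_dens integrable_sqrt_dens_mult integrable_hell2
      by (intro Bochner_Integration.integrable_add integrable_mult_right) auto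
    have le: "p \<theta> i x * ?G i x \<le> ?g x" "0 \<le> p \<theta> i x * ?G i x" "p \<theta>\<^sub>0 i x * (p \<theta> i x / p \<theta>\<^sub>0 i x * ?G i x) \<le> p \<theta> i x * ?G i x"
      if "x \<in> space (\<mu> i)" for x
    proof -
      have nn: "0 \<le> p \<theta>\<^sub>0 i x" "0 \<le> p c i x" "0 \<le> p \<theta> i x" using dens_nonneg that by auto
      show "p \<theta> i x * ?G i x \<le> ?g x"
        using square_times_root_ratio_perturbed_le[of "?a x" "?b x" "?f x"] nn
        by (simp add: algebra_simps power2_commute[of "?a x"])
      show "0 \<le> p \<theta> i x * ?G i x" using nn by (intro mult_nonneg_nonneg root_ratio_nonneg) auto
      then show "p \<theta>\<^sub>0 i x * (p \<theta> i x / p \<theta>\<^sub>0 i x * ?G i x) \<le> p \<theta> i x * ?G i x"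
        by (cases "p \<theta>\<^sub>0 i x = 0") simp_all
    qed
    have "(\<integral>\<^sup>+x. ennreal (p \<theta>\<^sub>0 i x * (p \<theta> i x / p \<theta>\<^sub>0 i x * ?G i x)) \<partial>\<mu> i) \<le> (\<integral>\<^sup>+x. ennreal (?g x) \<partial>\<mu> i)"
      using le by (intro nn_integral_mono ennreal_leI) (blast intro: order_trans)
    also have "\<dots> = ennreal (LINT x|\<mu> i. ?g x)"
      using int le by (intro nn_integral_eq_integral AE_I2) (blast intro: order_trans)+
    also have "(LINT x|\<mu> i. ?g x) = 1 + ?e i"
    proof -
      have "(LINT x|\<mu> i. ?g x) = - 20 / 11 * (LINT x|\<mu> i. p c i x) + 9 / 11 * (LINT x|\<mu> i. ?b x * ?a x)
        + 2 * (LINT x|\<mu> i. ?f x * ?b x) + 9 / 170 * hell2 i c \<theta>\<^sub>0 + 253 / 10 * hell2 i \<theta> c"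
        using integrable_dens integrable_sqrt_dens_mult integrable_hell2 unfolding hell2_def
        by (simp add: Bochner_Integration.integral_add)
      also have "\<dots> = 1 + ?e i"
        by (simp add: integral_dens affinity_eq hell2_commute[of i \<theta>\<^sub>0] field_simps)
      finally show ?thesis .
    qed
    also have "ennreal (1 + ?e i) \<le> ennreal (exp (?e i))"
      using exp_ge_add_one_self[of "?e i"] by (intro ennreal_leI) simp
    finally show ?thesis .
  qed
  have "(\<integral>\<^sup>+X. ennreal (lik_ratio n \<theta> X / lr_stat n c X) \<partial>P0 n)
    = (\<integral>\<^sup>+X. ennreal (\<Prod>i<n. p \<theta> i (X i) / p \<theta>\<^sub>0 i (X i) * ?G i (X i)) \<partial>P0 n)"
    by (simp add: lik_ratio_def lr_stat_def prod_dividef[symmetric]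
        root_ratio_swap[of "sqrt (p c i x)" "sqrt (p \<theta>\<^sub>0 i x)" for i x])
  also have "\<dots> = (\<Prod>i<n. \<integral>\<^sup>+x. ennreal (p \<theta>\<^sub>0 i x * (p \<theta> i x / p \<theta>\<^sub>0 i x * ?G i x)) \<partial>\<mu> i)"
    using dens_nonneg
    by (intro nn_integral_P0_prod borel_measurable_times borel_measurable_divide root_ratio_measurable
        mult_nonneg_nonneg divide_nonneg_nonneg root_ratio_nonneg) auto
  also have "\<dots> \<le> (\<Prod>i<n. ennreal (exp (?e i)))"
    using 1 by (intro prod_mono_ennreal) auto
  also have "\<dots> = ennreal (exp (- (333 / 935) * hell2_sum n c \<theta>\<^sub>0 + 243 / 10 * hell2_sum n \<theta> c))"
    by (simp add: prod_ennreal exp_sum[symmetric] hell2_sum_def sum_distrib_left sum.distrib sum_subtractf sum_negf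
        del: times_divide_eq_left)
  finally show ?thesis .
qed

end

section \<open>Kullback--Leibler neighbourhoods and the evidence\<close>

lemma measurable_log_ratio[measurable (raw)]:
  assumes [measurable]: "f \<in> borel_measurable M" "g \<in> borel_measurable M"
  shows "(\<lambda>x. log_ratio (f x) (g x)) \<in> borel_measurable M"
  unfolding log_ratio_def by measurable

lemma log_ratio_mult_cases:
  assumes "0 \<le> a" "0 \<le> b"
  shows "ereal a * log_ratio a b = (if 0 < a \<and> b = 0 then \<infinity> else ereal (a * ln (a / b)))"
  using assms[unfolded le_less] by (auto simp: log_ratio_def zero_ereal_def[symmetric])

text \<open>This is ln x <= x - 1 for x = b / a, which would even give b - a. The weaker bound b
  also covers b = 0 < a, where the default values make the left-hand side 0.\<close>

lemma neg_log_ratio_le: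
  fixes a b :: real
  assumes "0 \<le> a" "0 \<le> b"
  shows "- (a * ln (a / b)) \<le> b"
proof (cases "a = 0 \<or> b = 0")
  case False
  then have pos: "0 < a" "0 < b" using assms by auto
  have "ln (b / a) \<le> b / a - 1" using pos by (intro ln_le_minus_one) auto
  then have "a * ln (b / a) \<le> a * (b / a - 1)" using pos by (intro mult_left_mono) auto
  also have "\<dots> = b - a" using pos by (simp add: field_simps)
  finally show ?thesis using pos by (simp add: ln_div algebra_simps)
qed (use assms in auto)

text \<open>The negative part is dominated by g and so has finite integral. A divergence different
  from \<infinity> therefore has a finite positive part, which excludes f > 0 = g outside a null
  set; elsewhere the extended integrand agrees with the real one.\<close>

lemma KL_facts:
  fixes f g :: "'x \<Rightarrow> real"
  assumes [measurable]: "f \<in> borel_measurable M" "g \<in> borel_measurable M"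
    and f: "\<And>x. x \<in> space M \<Longrightarrow> 0 \<le> f x" and g: "\<And>x. x \<in> space M \<Longrightarrow> 0 \<le> g x"
    and intg: "integrable M g"
  shows KL_finite_AE: "KL M f g \<noteq> \<infinity> \<Longrightarrow> AE x in M. 0 < f x \<longrightarrow> 0 < g x"
    and KL_finite_integrable: "KL M f g \<noteq> \<infinity> \<Longrightarrow> integrable M (\<lambda>x. f x * ln (f x / g x))"
    and KL_finite_eq: "KL M f g \<noteq> \<infinity> \<Longrightarrow> KL M f g = ereal (LINT x|M. f x * ln (f x / g x))"
proof -
  define h where "h = (\<lambda>x. f x * ln (f x / g x))"
  define \<phi> where "\<phi> = (\<lambda>x. ereal (f x) * log_ratio (f x) (g x))"
  have [measurable]: "\<phi> \<in> borel_measurable M" "h \<in> borel_measurable M"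
    unfolding \<phi>_def h_def by measurable
  have \<phi>: "\<phi> x = (if 0 < f x \<and> g x = 0 then \<infinity> else ereal (h x))" if "x \<in> space M" for x
    using log_ratio_mult_cases[OF f[OF that] g[OF that]] by (simp add: \<phi>_def h_def)
  define A where "A = (\<integral>\<^sup>+x. e2ennreal (\<phi> x) \<partial>M)"
  define B where "B = (\<integral>\<^sup>+x. e2ennreal (- \<phi> x) \<partial>M)"
  have KL: "KL M f g = enn2ereal A - enn2ereal B"
    by (simp add: KL_def A_def B_def \<phi>_def)
  have neg: "- h x \<le> g x" if "x \<in> space M" for x
    using neg_log_ratio_le[OF f[OF that] g[OF that]] by (simp add: h_def)
  have intg_fin: "(\<integral>\<^sup>+x. ennreal (g x) \<partial>M) < \<infinity>"
    using intg g by (subst nn_integral_eq_integral) auto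
  have "B \<le> (\<integral>\<^sup>+x. ennreal (g x) \<partial>M)"
    unfolding B_def using \<phi> neg g by (intro nn_integral_mono) (auto simp: e2ennreal_neg intro: ennreal_leI)
  then have B: "B < \<infinity>" using intg_fin by (rule le_less_trans)
  have Bneq: "enn2ereal B \<noteq> \<infinity>" using B by simp
  have Bpos: "0 \<le> enn2ereal B" "0 \<le> enn2ereal A" by simp_all
  have "(\<integral>\<^sup>+x. ennreal (- h x) \<partial>M) \<le> (\<integral>\<^sup>+x. ennreal (g x) \<partial>M)"
    using neg by (intro nn_integral_mono ennreal_leI) auto
  then have hneg: "(\<integral>\<^sup>+x. ennreal (- h x) \<partial>M) < \<infinity>" using intg_fin by (rule le_less_trans)
  assume fin: "KL M f g \<noteq> \<infinity>"
  have A: "A < \<infinity>"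
  proof (rule ccontr)
    assume "\<not> A < \<infinity>"
    then have "A = \<infinity>" by (simp add: top.not_eq_extremum[symmetric])
    then show False using fin Bneq Bpos unfolding KL by (cases "enn2ereal B") auto
  qed
  have "AE x in M. e2ennreal (\<phi> x) \<noteq> \<infinity>"
    using A unfolding A_def by (intro nn_integral_PInf_AE) auto
  then show AE: "AE x in M. 0 < f x \<longrightarrow> 0 < g x"
    using AE_space by eventually_elim (use \<phi> g in \<open>force simp: less_le\<close>)
  have AE_\<phi>: "AE x in M. \<phi> x = ereal (h x)"
    using AE AE_space by eventually_elim (use \<phi> in auto)
  have A_eq: "A = (\<integral>\<^sup>+x. ennreal (h x) \<partial>M)" and B_eq: "B = (\<integral>\<^sup>+x. ennreal (- h x) \<partial>M)"
    unfolding A_def B_def using AE_\<phi> by (auto intro!: nn_integral_cong_AE)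
  have int: "integrable M h"
    using A B hneg by (auto simp: real_integrable_def A_eq B_eq)
  then show "integrable M (\<lambda>x. f x * ln (f x / g x))" by (simp add: h_def)
  have "(LINT x|M. h x) = enn2real A - enn2real B"
    using real_lebesgue_integral_def[OF int] by (simp add: A_eq B_eq)
  moreover have "enn2ereal A = ereal (enn2real A)" "enn2ereal B = ereal (enn2real B)"
    using A B by (auto simp: enn2ereal_ennreal[symmetric] less_top[symmetric] ennreal_enn2real_if simp del: enn2ereal_ennreal)
  ultimately show "KL M f g = ereal (LINT x|M. f x * ln (f x / g x))"
    unfolding KL by (simp add: h_def)
qed

lemma KL_var_eq:
  fixes f g :: "'x \<Rightarrow> real"
  assumes f: "\<And>x. x \<in> space M \<Longrightarrow> 0 \<le> f x"
    and AE: "AE x in M. 0 < f x \<longrightarrow> 0 < g x" and KL: "KL M f g = ereal \<kappa>"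
  shows "KL_var k M f g = (\<integral>\<^sup>+x. ennreal (f x * \<bar>ln (f x / g x) - \<kappa>\<bar> powr k) \<partial>M)"
  unfolding KL_var_def
proof (rule nn_integral_cong_AE)
  show "AE x in M. ennreal (f x) * abs_powr (log_ratio (f x) (g x) - KL M f g) k
      = ennreal (f x * \<bar>ln (f x / g x) - \<kappa>\<bar> powr k)"
    using AE AE_space
  proof eventually_elim
    case (elim x)
    then show ?case using f[of x]
      by (cases "f x = 0") (auto simp: KL log_ratio_def abs_powr_def ennreal_mult)
  qed
qed

section \<open>Real-valued consequences of membership in the neighbourhood\<close>

context product_model begin

definition log_lr :: "'p \<Rightarrow> nat \<Rightarrow> 'x \<Rightarrow> real" where
  "log_lr \<theta> i x = ln (p \<theta>\<^sub>0 i x / p \<theta> i x)"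

definition kl :: "'p \<Rightarrow> nat \<Rightarrow> real" where
  "kl \<theta> i = (LINT x|\<mu> i. p \<theta>\<^sub>0 i x * log_lr \<theta> i x)"

lemma log_lr_measurable: "\<theta> \<in> space T \<Longrightarrow> log_lr \<theta> i \<in> borel_measurable (\<mu> i)"
  unfolding log_lr_def[abs_def] by measurable

text \<open>This converts the two extended-valued constraints into the hypotheses of the moment
  inequality for centred log-likelihood ratios. The sign of \<open>C\<close> is left open, and
  \<open>ennreal\<close> truncates a negative bound to 0; hence the \<open>max 0\<close>.\<close>

lemma KL_nbhd_facts:
  assumes \<theta>: "\<theta> \<in> KL_nbhd \<mu> p (space T) C n \<theta>\<^sub>0 \<epsilon> k" and n: "1 \<le> n"
  shows KL_nbhd_space: "\<theta> \<in> space T"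
    and KL_nbhd_AE: "i < n \<Longrightarrow> AE x in \<mu> i. 0 < p \<theta>\<^sub>0 i x \<longrightarrow> 0 < p \<theta> i x"
    and KL_nbhd_sum: "(\<Sum>i<n. kl \<theta> i) \<le> real n * \<epsilon>\<^sup>2"
    and KL_nbhd_integrable: "i < n \<Longrightarrow> integrable (law \<mu> p \<theta>\<^sub>0 i) (\<lambda>x. log_lr \<theta> i x - kl \<theta> i)"
    and KL_nbhd_mean: "i < n \<Longrightarrow> (LINT x|law \<mu> p \<theta>\<^sub>0 i. log_lr \<theta> i x - kl \<theta> i) = 0"
    and KL_nbhd_integrable_powr: "i < n \<Longrightarrow> integrable (law \<mu> p \<theta>\<^sub>0 i) (\<lambda>x. \<bar>log_lr \<theta> i x - kl \<theta> i\<bar> powr k)"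
    and KL_nbhd_powr: "(\<Sum>i<n. LINT x|law \<mu> p \<theta>\<^sub>0 i. \<bar>log_lr \<theta> i x - kl \<theta> i\<bar> powr k)
        \<le> real n * max 0 (inverse C * \<epsilon> powr k)"
proof -
  show sp[simp]: "\<theta> \<in> space T" using \<theta> by (simp add: KL_nbhd_def)
  note [simp] = true_param
  let ?K = "\<lambda>i. KL (\<mu> i) (p \<theta>\<^sub>0 i) (p \<theta> i)"
  have le: "(\<Sum>i<n. ?K i) / ereal (real n) \<le> ereal (\<epsilon>\<^sup>2)"
    and vle: "(\<Sum>i<n. KL_var k (\<mu> i) (p \<theta>\<^sub>0 i) (p \<theta> i)) / ennreal (real n) \<le> ennreal (inverse C * \<epsilon> powr k)"
    using \<theta> by (auto simp: KL_nbhd_def)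
  \<comment> \<open>In \<open>ereal\<close> the sum of \<infinity> and -\<infinity> is \<infinity>,
    so one infinite divergence makes the whole sum infinite, whatever the other terms are.\<close>
  have fin: "?K i \<noteq> \<infinity>" if "i < n" for i
  proof
    assume "?K i = \<infinity>"
    with that have "(\<Sum>i<n. ?K i) = \<infinity>" by (subst sum_Pinfty) auto
    with le n show False by simp
  qed
  note kf = KL_finite_AE[OF dens0_measurable dens_measurable dens_nonneg dens_nonneg integrable_dens]
    KL_finite_integrable[OF dens0_measurable dens_measurable dens_nonneg dens_nonneg integrable_dens]
    KL_finite_eq[OF dens0_measurable dens_measurable dens_nonneg dens_nonneg integrable_dens]
  have ae: "AE x in \<mu> i. 0 < p \<theta>\<^sub>0 i x \<longrightarrow> 0 < p \<theta> i x" if "i < n" for i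
    using fin[OF that] by (intro kf(1)) auto
  then show "i < n \<Longrightarrow> AE x in \<mu> i. 0 < p \<theta>\<^sub>0 i x \<longrightarrow> 0 < p \<theta> i x" .
  have int: "integrable (\<mu> i) (\<lambda>x. p \<theta>\<^sub>0 i x * log_lr \<theta> i x)" if "i < n" for i
    unfolding log_lr_def using fin[OF that] by (intro kf(2)) auto
  have eq: "?K i = ereal (kl \<theta> i)" if "i < n" for i
    unfolding log_lr_def kl_def using fin[OF that] by (intro kf(3)) auto
  have "(\<Sum>i<n. ?K i) = ereal (\<Sum>i<n. kl \<theta> i)" using eq by simp
  with le n show "(\<Sum>i<n. kl \<theta> i) \<le> real n * \<epsilon>\<^sup>2" by (simp add: field_simps)
  have meas[measurable]: "log_lr \<theta> i \<in> borel_measurable (\<mu> i)" for i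
    by (intro log_lr_measurable) simp
  have dAE: "AE x in \<mu> i. 0 \<le> p \<theta>\<^sub>0 i x" for i using dens_nonneg by (intro AE_I2) auto
  show "integrable (law \<mu> p \<theta>\<^sub>0 i) (\<lambda>x. log_lr \<theta> i x - kl \<theta> i)"
    "(LINT x|law \<mu> p \<theta>\<^sub>0 i. log_lr \<theta> i x - kl \<theta> i) = 0" if "i < n"
  proof -
    have i2: "integrable (\<mu> i) (\<lambda>x. p \<theta>\<^sub>0 i x * (log_lr \<theta> i x - kl \<theta> i))"
      using int[OF that] integrable_dens[of \<theta>\<^sub>0 i] by (simp add: right_diff_distrib)
    show "integrable (law \<mu> p \<theta>\<^sub>0 i) (\<lambda>x. log_lr \<theta> i x - kl \<theta> i)"
      unfolding law_def using i2 dAE by (subst integrable_real_density) auto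
    have "(LINT x|law \<mu> p \<theta>\<^sub>0 i. log_lr \<theta> i x - kl \<theta> i) = (LINT x|\<mu> i. p \<theta>\<^sub>0 i x * (log_lr \<theta> i x - kl \<theta> i))"
      unfolding law_def using dAE by (subst integral_real_density) auto
    also have "\<dots> = kl \<theta> i - kl \<theta> i * (LINT x|\<mu> i. p \<theta>\<^sub>0 i x)"
      using int[OF that] integrable_dens[of \<theta>\<^sub>0 i] by (simp add: right_diff_distrib kl_def)
    finally show "(LINT x|law \<mu> p \<theta>\<^sub>0 i. log_lr \<theta> i x - kl \<theta> i) = 0"
      by (simp add: integral_dens)
  qed
  let ?V = "\<lambda>i. KL_var k (\<mu> i) (p \<theta>\<^sub>0 i) (p \<theta> i)"
  have V: "?V i = (\<integral>\<^sup>+x. ennreal (\<bar>log_lr \<theta> i x - kl \<theta> i\<bar> powr k) \<partial>law \<mu> p \<theta>\<^sub>0 i)" if "i < n" for i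
  proof -
    have "?V i = (\<integral>\<^sup>+x. ennreal (p \<theta>\<^sub>0 i x * \<bar>log_lr \<theta> i x - kl \<theta> i\<bar> powr k) \<partial>\<mu> i)"
      unfolding log_lr_def using ae[OF that] eq[OF that] dens_nonneg by (intro KL_var_eq) auto
    also have "\<dots> = (\<integral>\<^sup>+x. ennreal (\<bar>log_lr \<theta> i x - kl \<theta> i\<bar> powr k) \<partial>law \<mu> p \<theta>\<^sub>0 i)"
      using dens_nonneg by (subst nn_integral_law) (auto simp: ennreal_mult intro!: nn_integral_cong)
    finally show ?thesis .
  qed
  have "(\<Sum>i<n. ?V i) = (\<Sum>i<n. ?V i) / ennreal (real n) * ennreal (real n)"
    using n by (simp add: ennreal_divide_times)
  also have "\<dots> \<le> ennreal (inverse C * \<epsilon> powr k) * ennreal (real n)"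
    using vle by (intro mult_right_mono) auto
  also have "\<dots> = ennreal (real n * max 0 (inverse C * \<epsilon> powr k))"
    by (simp add: ennreal_mult mult.commute max_def ennreal_neg)
  finally have Vsum: "(\<Sum>i<n. ?V i) \<le> ennreal (real n * max 0 (inverse C * \<epsilon> powr k))" .
  have Vfin: "?V i < \<infinity>" if "i < n" for i
  proof -
    have "?V i \<le> (\<Sum>i<n. ?V i)" using that by (intro member_le_sum) auto
    also have "\<dots> \<le> ennreal (real n * max 0 (inverse C * \<epsilon> powr k))" by (rule Vsum)
    also have "\<dots> < \<infinity>" by simp
    finally show ?thesis .
  qed
  show intp: "integrable (law \<mu> p \<theta>\<^sub>0 i) (\<lambda>x. \<bar>log_lr \<theta> i x - kl \<theta> i\<bar> powr k)" if "i < n" for i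
    using Vfin[OF that] V[OF that] by (intro integrableI_nonneg) auto
  have "ennreal (\<Sum>i<n. LINT x|law \<mu> p \<theta>\<^sub>0 i. \<bar>log_lr \<theta> i x - kl \<theta> i\<bar> powr k)
      = (\<Sum>i<n. ennreal (LINT x|law \<mu> p \<theta>\<^sub>0 i. \<bar>log_lr \<theta> i x - kl \<theta> i\<bar> powr k))"
    by (intro sum_ennreal[symmetric]) simp
  also have "\<dots> = (\<Sum>i<n. ?V i)"
    using intp V by (intro sum.cong refl) (auto simp: nn_integral_eq_integral)
  also note Vsum
  finally show "(\<Sum>i<n. LINT x|law \<mu> p \<theta>\<^sub>0 i. \<bar>log_lr \<theta> i x - kl \<theta> i\<bar> powr k)
        \<le> real n * max 0 (inverse C * \<epsilon> powr k)"
    by (subst (asm) ennreal_le_iff) auto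
qed

text \<open>The factor \<open>inverse C\<close> in the definition of the neighbourhood cancels the
  constant of the moment inequality. If \<open>C\<close> were not positive, the moment bound would
  be at most 0 and the claim would hold all the more.\<close>

lemma log_lik_moment_bound:
  assumes \<theta>: "\<theta> \<in> KL_nbhd \<mu> p (space T) C n \<theta>\<^sub>0 \<epsilon> k" and n: "1 \<le> n"
    and C: "mz_constant k C" and k: "1 \<le> k"
  shows "(\<integral>\<^sup>+X. ennreal (\<bar>\<Sum>i<n. log_lr \<theta> i (X i) - kl \<theta> i\<bar> powr k) \<partial>P0 n)
    \<le> ennreal (real n powr (k / 2) * \<epsilon> powr k)"
proof -
  note facts = KL_nbhd_facts[OF \<theta> n]
  let ?S = "\<Sum>i<n. LINT x|law \<mu> p \<theta>\<^sub>0 i. \<bar>log_lr \<theta> i x - kl \<theta> i\<bar> powr k"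
  have m: "log_lr \<theta> i \<in> borel_measurable (law \<mu> p \<theta>\<^sub>0 i)" for i
    using log_lr_measurable[OF facts(1), of i] by simp
  have "(\<integral>\<^sup>+X. ennreal (\<bar>\<Sum>i<n. log_lr \<theta> i (X i) - kl \<theta> i\<bar> powr k) \<partial>P0 n)
    \<le> ennreal (real n powr (k / 2) * (C * (?S / real n)))"
    unfolding joint_law_def using facts m n k C dens_prob true_param
    by (intro mz_constant_sum_bound) auto
  also have "\<dots> \<le> ennreal (real n powr (k / 2) * \<epsilon> powr k)"
  proof (intro ennreal_leI mult_left_mono)
    have S0: "0 \<le> ?S / real n" by (intro divide_nonneg_nonneg sum_nonneg) auto
    show "C * (?S / real n) \<le> \<epsilon> powr k"
    proof (cases "0 < C")
      case True
      have "?S / real n \<le> max 0 (inverse C * \<epsilon> powr k)"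
        using facts(7) n by (simp add: field_simps)
      also have "\<dots> = inverse C * \<epsilon> powr k" using True by (simp add: max_def)
      finally have "C * (?S / real n) \<le> C * (inverse C * \<epsilon> powr k)"
        using True by (intro mult_left_mono) auto
      also have "\<dots> = \<epsilon> powr k" using True by (simp add: field_simps)
      finally show ?thesis .
    next
      case False
      then have "C * (?S / real n) \<le> 0" using S0 by (intro mult_nonpos_nonneg) auto
      also have "0 \<le> \<epsilon> powr k" by simp
      finally show ?thesis .
    qed
  qed auto
  finally show ?thesis .
qed

section \<open>Joint measurability in parameter and observation, and means under theta_0\<close>

lemma dens_joint_measurable:
  assumes Q: "sets Q = sets T" and i: "i < n"
  shows "(\<lambda>(\<theta>, X). p \<theta> i (X i)) \<in> borel_measurable (Q \<Otimes>\<^sub>M P0 n)"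
proof -
  have [measurable]: "(\<lambda>X. X i) \<in> measurable (P0 n) (\<mu> i)" using i by (rule coord_measurable)
  have [measurable]: "(\<lambda>(\<theta>, x). p \<theta> i x) \<in> borel_measurable (Q \<Otimes>\<^sub>M \<mu> i)"
    using dens_meas[of i] by (simp add: measurable_cong_sets[OF sets_pair_measure_cong[OF Q refl] refl])
  have "(\<lambda>z. case (\<lambda>(\<theta>, X). (\<theta>, X i)) z of (\<theta>, x) \<Rightarrow> p \<theta> i x) \<in> borel_measurable (Q \<Otimes>\<^sub>M P0 n)"
    by (rule measurable_compose[where N="Q \<Otimes>\<^sub>M \<mu> i"]) measurable
  then show ?thesis by (simp add: case_prod_beta)
qed

lemma dens0_joint_measurable:
  assumes i: "i < n"
  shows "(\<lambda>(\<theta>, X). p \<theta>\<^sub>0 i (X i)) \<in> borel_measurable (Q \<Otimes>\<^sub>M P0 n)"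
  using coord_compose_measurable[OF i dens0_measurable] by measurable

lemma lik_ratio_joint_measurable:
  assumes Q: "sets Q = sets T"
  shows "(\<lambda>(\<theta>, X). lik_ratio n \<theta> X) \<in> borel_measurable (Q \<Otimes>\<^sub>M P0 n)"
proof -
  have "(\<lambda>z. \<Prod>i<n. (case z of (\<theta>, X) \<Rightarrow> p \<theta> i (X i)) / (case z of (\<theta>, X) \<Rightarrow> p \<theta>\<^sub>0 i (X i)))
      \<in> borel_measurable (Q \<Otimes>\<^sub>M P0 n)"
    using dens_joint_measurable[OF Q] dens0_joint_measurable
    by (intro borel_measurable_prod borel_measurable_divide) auto
  then show ?thesis by (simp add: lik_ratio_def case_prod_beta)
qed

lemma kl_measurable: "(\<lambda>\<theta>. kl \<theta> i) \<in> borel_measurable T"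
  unfolding kl_def log_lr_def
proof (rule sigma_finite_measure.borel_measurable_lebesgue_integral[OF sigma_finite])
  show "(\<lambda>(\<theta>, x). p \<theta>\<^sub>0 i x * ln (p \<theta>\<^sub>0 i x / p \<theta> i x)) \<in> borel_measurable (T \<Otimes>\<^sub>M \<mu> i)"
    using dens_meas[of i] by measurable
qed

lemma lik_ratio_mean_le:
  assumes \<theta>: "\<theta> \<in> space T"
  shows "(\<integral>\<^sup>+X. ennreal (lik_ratio n \<theta> X) \<partial>P0 n) \<le> 1"
proof -
  have "(\<integral>\<^sup>+X. ennreal (lik_ratio n \<theta> X) \<partial>P0 n)
    = (\<Prod>i<n. \<integral>\<^sup>+x. ennreal (p \<theta>\<^sub>0 i x * (p \<theta> i x / p \<theta>\<^sub>0 i x)) \<partial>\<mu> i)"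
    unfolding lik_ratio_def using dens_nonneg \<theta> true_param
    by (intro nn_integral_P0_prod borel_measurable_divide divide_nonneg_nonneg) auto
  also have "\<dots> \<le> (\<Prod>i<n. \<integral>\<^sup>+x. ennreal (p \<theta> i x) \<partial>\<mu> i)"
    using dens_nonneg[OF \<theta>] by (intro prod_mono_ennreal nn_integral_mono ennreal_leI) auto
  also have "\<dots> = 1" using \<theta> by (simp add: nn_integral_dens)
  finally show ?thesis .
qed

text \<open>\<open>\<infinity>\<close> on the null set where some density vanishes, so that the pointwise inequality used for
  the evidence bound holds without exception.\<close>

definition log_lik_penalty :: "real \<Rightarrow> nat \<Rightarrow> 'p \<Rightarrow> (nat \<Rightarrow> 'x) \<Rightarrow> ennreal" where
  "log_lik_penalty k n \<theta> X = (if \<exists>i<n. p \<theta> i (X i) = 0 then \<infinity>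
     else ennreal (\<bar>\<Sum>i<n. log_lr \<theta> i (X i) - kl \<theta> i\<bar> powr k))"

lemma log_lik_penalty_measurable:
  assumes Q: "sets Q = sets T"
  shows "(\<lambda>(\<theta>, X). log_lik_penalty k n \<theta> X) \<in> borel_measurable (Q \<Otimes>\<^sub>M P0 n)"
proof -
  let ?M = "Q \<Otimes>\<^sub>M P0 n"
  have d[measurable]: "(\<lambda>z. p (fst z) i (snd z i)) \<in> borel_measurable ?M" if "i < n" for i
    using dens_joint_measurable[OF Q that] by (simp only: case_prod_beta')
  have d0[measurable]: "(\<lambda>z. p \<theta>\<^sub>0 i (snd z i)) \<in> borel_measurable ?M" if "i < n" for i
    using dens0_joint_measurable[OF that, of Q] by (simp only: case_prod_beta')
  have kl[measurable]: "(\<lambda>z. kl (fst z) i) \<in> borel_measurable ?M" for i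
  proof -
    have "(\<lambda>\<theta>. kl \<theta> i) \<in> borel_measurable Q"
      using kl_measurable[of i] by (simp add: measurable_cong_sets[OF Q refl])
    then show ?thesis by (rule measurable_compose[OF measurable_fst])
  qed
  have s[measurable]: "(\<lambda>z. \<Sum>i<n. log_lr (fst z) i (snd z i) - kl (fst z) i) \<in> borel_measurable ?M"
    unfolding log_lr_def by (intro borel_measurable_sum borel_measurable_diff borel_measurable_ln
        borel_measurable_divide kl d d0) auto
  have e: "Measurable.pred ?M (\<lambda>z. \<exists>i<n. p (fst z) i (snd z i) = 0)"
  proof -
    have "Measurable.pred ?M (\<lambda>z. \<exists>i\<in>{..<n}. p (fst z) i (snd z i) = 0)"
    proof (intro pred_intros_finite(4))
      fix i assume "i \<in> {..<n}"
      then have [measurable]: "(\<lambda>z. p (fst z) i (snd z i)) \<in> borel_measurable ?M" using d by simp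
      show "Measurable.pred ?M (\<lambda>z. p (fst z) i (snd z i) = 0)" by measurable
    qed simp
    then show ?thesis by (simp add: Bex_def)
  qed
  note [measurable] = e
  show ?thesis unfolding log_lik_penalty_def case_prod_beta by measurable
qed

text \<open>The value \<infinity> does not contribute to the mean: finite divergence makes the
  density of theta positive almost everywhere where that of theta_0 is.\<close>

lemma log_lik_penalty_mean_le:
  assumes \<theta>: "\<theta> \<in> KL_nbhd \<mu> p (space T) C n \<theta>\<^sub>0 \<epsilon> k" and n: "1 \<le> n"
    and C: "mz_constant k C" and k: "1 \<le> k"
  shows "(\<integral>\<^sup>+X. log_lik_penalty k n \<theta> X \<partial>P0 n) \<le> ennreal (real n powr (k / 2) * \<epsilon> powr k)"
proof -
  have \<theta>T: "\<theta> \<in> space T" by (rule KL_nbhd_space[OF \<theta> n])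
  have "AE X in P0 n. p \<theta>\<^sub>0 i (X i) > 0 \<longrightarrow> p \<theta> i (X i) > 0" if i: "i < n" for i
    unfolding joint_law_def
  proof (rule AE_PiM_component)
    show "AE x in law \<mu> p \<theta>\<^sub>0 i. 0 < p \<theta>\<^sub>0 i x \<longrightarrow> 0 < p \<theta> i x"
      unfolding law_def using KL_nbhd_AE[OF \<theta> n i] by (subst AE_density) auto
  qed (use i dens_prob true_param in auto)
  then have "AE X in P0 n. \<forall>i\<in>{..<n}. p \<theta>\<^sub>0 i (X i) > 0 \<longrightarrow> p \<theta> i (X i) > 0"
    by (intro AE_finite_allI) auto
  then have "AE X in P0 n. log_lik_penalty k n \<theta> X = ennreal (\<bar>\<Sum>i<n. log_lr \<theta> i (X i) - kl \<theta> i\<bar> powr k)"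
    using AE_P0_dens_pos by eventually_elim (force simp: log_lik_penalty_def)
  then have "(\<integral>\<^sup>+X. log_lik_penalty k n \<theta> X \<partial>P0 n)
     = (\<integral>\<^sup>+X. ennreal (\<bar>\<Sum>i<n. log_lr \<theta> i (X i) - kl \<theta> i\<bar> powr k) \<partial>P0 n)"
    by (intro nn_integral_cong_AE)
  with log_lik_moment_bound[OF assms] show ?thesis by simp
qed

text \<open>With w the centred log-likelihood ratio, the likelihood ratio is exp(-w) times the
  exponential of minus the summed divergences, which are at most n eps^2. So
  \<open>exp_minus_powr_lower_bound\<close> applies after multiplication by exp(n eps^2). Where a
  density of theta vanishes, the penalty makes the right-hand side infinite.\<close>

lemma lik_ratio_lower_bound:
  assumes \<theta>: "\<theta> \<in> KL_nbhd \<mu> p (space T) C n \<theta>\<^sub>0 \<epsilon> k" and n: "1 \<le> n" and k: "1 \<le> k" and a: "0 < a"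
    and X: "X \<in> space (P0 n)" "\<forall>i<n. 0 < p \<theta>\<^sub>0 i (X i)"
  shows "ennreal (exp (- a) * (1 + a / k)) \<le> ennreal (exp (real n * \<epsilon>\<^sup>2)) * ennreal (lik_ratio n \<theta> X)
    + ennreal (exp (- a) * (a powr (1 - k) / k)) * log_lik_penalty k n \<theta> X"
proof (cases "\<exists>i<n. p \<theta> i (X i) = 0")
  case True
  then show ?thesis using a k by (simp add: log_lik_penalty_def ennreal_mult_top)
next
  case False
  have \<theta>T: "\<theta> \<in> space T" by (rule KL_nbhd_space[OF \<theta> n])
  have pos: "0 < p \<theta> i (X i)" if "i < n" for i
    using False dens_nonneg[OF \<theta>T coord_space[OF X(1) that]] that by (auto simp: less_le)
  let ?w = "\<Sum>i<n. log_lr \<theta> i (X i) - kl \<theta> i"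
  let ?s = "real n * \<epsilon>\<^sup>2"
  have "lik_ratio n \<theta> X = (\<Prod>i<n. exp (- log_lr \<theta> i (X i)))"
    unfolding lik_ratio_def using pos X(2)
    by (intro prod.cong refl) (auto simp: log_lr_def exp_minus)
  also have "\<dots> = exp (- ?w - (\<Sum>i<n. kl \<theta> i))"
    by (simp add: exp_sum[symmetric] sum_subtractf sum_negf)
  finally have "exp (- ?w - ?s) \<le> lik_ratio n \<theta> X"
    using KL_nbhd_sum[OF \<theta> n] by simp
  then have "exp ?s * exp (- ?w - ?s) \<le> exp ?s * lik_ratio n \<theta> X" by (intro mult_left_mono) auto
  then have 1: "exp (- ?w) \<le> exp ?s * lik_ratio n \<theta> X" by (simp add: mult_exp_exp)
  have "exp (- a) * (1 + a / k) \<le> exp ?s * lik_ratio n \<theta> X + exp (- a) * (a powr (1 - k) / k) * \<bar>?w\<bar> powr k"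
    using exp_minus_powr_lower_bound[OF a k, of ?w] 1 by linarith
  then have "ennreal (exp (- a) * (1 + a / k))
    \<le> ennreal (exp ?s * lik_ratio n \<theta> X + exp (- a) * (a powr (1 - k) / k) * \<bar>?w\<bar> powr k)"
    by (rule ennreal_leI)
  also have "\<dots> = ennreal (exp ?s) * ennreal (lik_ratio n \<theta> X)
    + ennreal (exp (- a) * (a powr (1 - k) / k)) * log_lik_penalty k n \<theta> X"
  proof -
    have "log_lik_penalty k n \<theta> X = ennreal (\<bar>?w\<bar> powr k)"
      using False by (simp only: log_lik_penalty_def if_False)
    moreover have "0 \<le> exp (- a) * (a powr (1 - k) / k)" using k by simp
    ultimately show ?thesis using lik_ratio_nonneg[OF \<theta>T X(1)]
      by (subst ennreal_plus) (auto simp: ennreal_mult simp del: times_divide_eq_right)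
  qed
  finally show ?thesis .
qed

text \<open>With s = n eps^2, the divergence costs a factor exp(-s) and the fluctuation a factor
  exp(-D s). The failure probability from Markov's inequality is s^(k/2) / (D s)^k = (D^2 s)^(-k/2),
  and k >= 2 together with D^2 s >= 1 reduces it to 1 / (D^2 s).\<close>

lemma evidence_lower_bound:
  fixes Q :: "'p measure" and \<epsilon> D k C :: real
  assumes Q: "sets Q = sets T" "prob_space Q" and n: "1 \<le> n" and C: "mz_constant k C" and k: "2 \<le> k"
    and \<epsilon>: "0 < \<epsilon>" and D: "0 < D" "1 \<le> D\<^sup>2 * (real n * \<epsilon>\<^sup>2)"
  defines "B \<equiv> KL_nbhd \<mu> p (space T) C n \<theta>\<^sub>0 \<epsilon> k"
  assumes pos: "0 < measure Q B"
  shows "emeasure (P0 n) {X\<in>space (P0 n). (\<integral>\<^sup>+\<theta>. ennreal (lik_ratio n \<theta> X) \<partial>Q)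
       < ennreal (measure Q B * exp (- (1 + D) * (real n * \<epsilon>\<^sup>2)))} \<le> ennreal (1 / (D\<^sup>2 * (real n * \<epsilon>\<^sup>2)))"
proof -
  interpret Q: prob_space Q by fact
  interpret P0: prob_space "P0 n" by (rule prob_space_P0)
  interpret PS: pair_sigma_finite Q "P0 n" ..
  define s where "s = real n * \<epsilon>\<^sup>2"
  define a where "a = D * s"
  define b where "b = measure Q B"
  have s: "0 < s" using n \<epsilon> by (simp add: s_def)
  have a: "0 < a" using D s by (simp add: a_def)
  have b: "0 < b" using pos by (simp add: b_def)
  \<comment> \<open>A set outside the sigma-field has measure 0 by default, so positive mass already
    yields measurability of the neighbourhood.\<close>
  have B[measurable]: "B \<in> sets Q" using pos measure_notin_sets by fastforce
  have Bb: "emeasure Q B = ennreal b" by (simp add: b_def Q.emeasure_eq_measure)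
  have BT: "\<theta> \<in> space T" if "\<theta> \<in> B" for \<theta> using that by (simp add: B_def KL_nbhd_def)
  note lm[measurable] = lik_ratio_joint_measurable[OF Q(1), of n]
  note pm[measurable] = log_lik_penalty_measurable[OF Q(1), of k n]
  define I where "I = (\<lambda>X. \<integral>\<^sup>+\<theta>. ennreal (lik_ratio n \<theta> X) * indicator B \<theta> \<partial>Q)"
  define H where "H = (\<lambda>X. \<integral>\<^sup>+\<theta>. log_lik_penalty k n \<theta> X * indicator B \<theta> \<partial>Q)"
  have sw: "(\<lambda>(X, \<theta>). f \<theta> X) \<in> borel_measurable (P0 n \<Otimes>\<^sub>M Q)"
    if "(\<lambda>(\<theta>, X). f \<theta> X) \<in> borel_measurable (Q \<Otimes>\<^sub>M P0 n)" for f :: "'p \<Rightarrow> (nat \<Rightarrow> 'x) \<Rightarrow> 'b::topological_space"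
    using measurable_pair_swap[OF that] by simp
  note [measurable] = sw[OF lm] sw[OF pm]
  have Hm[measurable]: "H \<in> borel_measurable (P0 n)"
    unfolding H_def by measurable
  have lmX: "(\<lambda>\<theta>. lik_ratio n \<theta> X) \<in> borel_measurable Q" "(\<lambda>\<theta>. log_lik_penalty k n \<theta> X) \<in> borel_measurable Q"
    if "X \<in> space (P0 n)" for X
    using measurable_Pair_compose_split[OF lm measurable_ident measurable_const[OF that]]
      measurable_Pair_compose_split[OF pm measurable_ident measurable_const[OF that]] by simp_all
  have "(\<integral>\<^sup>+X. H X \<partial>P0 n) = (\<integral>\<^sup>+\<theta>. (\<integral>\<^sup>+X. log_lik_penalty k n \<theta> X * indicator B \<theta> \<partial>P0 n) \<partial>Q)"
    unfolding H_def by (rule PS.Fubini') measurable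
  also have "\<dots> \<le> (\<integral>\<^sup>+\<theta>. ennreal (real n powr (k / 2) * \<epsilon> powr k) * indicator B \<theta> \<partial>Q)"
    using log_lik_penalty_mean_le[OF _ n C, of _ \<epsilon>] k
    by (intro nn_integral_mono) (auto simp: B_def indicator_def)
  also have "\<dots> = ennreal (real n powr (k / 2) * \<epsilon> powr k) * ennreal b"
    by (simp add: nn_integral_cmult_indicator Bb)
  also have "real n powr (k / 2) * \<epsilon> powr k = s powr (k / 2)"
    using n \<epsilon> by (simp add: s_def powr_mult powr_powr flip: powr_numeral)
  finally have EH: "(\<integral>\<^sup>+X. H X \<partial>P0 n) \<le> ennreal (s powr (k / 2) * b)"
    using b by (simp add: ennreal_mult)
  \<comment> \<open>The part without probability: a moderate average penalty forces large evidence.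
    The threshold \<open>b * a powr k\<close> is the one at which the averaged penalty cancels the
    term with a / k in the pointwise inequality.\<close>
  have key: "AE X in P0 n. H X \<le> ennreal (b * a powr k) \<longrightarrow> ennreal (b * exp (- (1 + D) * s)) \<le> I X"
    using AE_P0_dens_pos AE_space
  proof eventually_elim
    case (elim X)
    show ?case
    proof
      assume HX: "H X \<le> ennreal (b * a powr k)"
      let ?c = "exp (- a) * (a powr (1 - k) / k)"
      have c: "0 \<le> ?c" using k by simp
      have "ennreal (exp (- a) * (1 + a / k)) * ennreal b
        = (\<integral>\<^sup>+\<theta>. ennreal (exp (- a) * (1 + a / k)) * indicator B \<theta> \<partial>Q)"
        by (simp add: nn_integral_cmult_indicator Bb)
      also have "\<dots> \<le> (\<integral>\<^sup>+\<theta>. ennreal (exp s) * (ennreal (lik_ratio n \<theta> X) * indicator B \<theta>)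
          + ennreal ?c * (log_lik_penalty k n \<theta> X * indicator B \<theta>) \<partial>Q)"
        using lik_ratio_lower_bound[OF _ n _ a elim(2,1), of _ C \<epsilon> k] k unfolding s_def
        by (intro nn_integral_mono) (auto simp: B_def indicator_def)
      also have "\<dots> = ennreal (exp s) * I X + ennreal ?c * H X"
        unfolding I_def H_def using lmX[OF elim(2)]
        by (subst nn_integral_add) (auto simp: nn_integral_cmult)
      also have "\<dots> \<le> ennreal (exp s) * I X + ennreal ?c * ennreal (b * a powr k)"
        using HX by (intro add_left_mono mult_left_mono) auto
      also have "ennreal ?c * ennreal (b * a powr k) = ennreal (exp (- a) * (a / k) * b)"
      proof -
        have "a powr (1 - k) * a powr k = a" using a by (simp add: powr_add[symmetric])
        then have "?c * (b * a powr k) = exp (- a) * (a / k) * b" by (simp add: field_simps)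
        moreover have "ennreal ?c * ennreal (b * a powr k) = ennreal (?c * (b * a powr k))"
          using c b by (intro ennreal_mult[symmetric]) auto
        ultimately show ?thesis by (simp only:)
      qed
      finally have 1: "ennreal (exp (- a) * (1 + a / k)) * ennreal b
         \<le> ennreal (exp s) * I X + ennreal (exp (- a) * (a / k) * b)" .
      have "ennreal (exp (- a) * (1 + a / k)) * ennreal b
        = ennreal (exp (- a) * b) + ennreal (exp (- a) * (a / k) * b)"
        using a b k by (simp add: ennreal_mult[symmetric] ennreal_plus[symmetric] algebra_simps del: ennreal_plus)
      \<comment> \<open>The common summand is moved to the front because it is finite, and only a
        finite summand may be cancelled in \<open>ennreal\<close>.\<close>
      with 1 have "ennreal (exp (- a) * (a / k) * b) + ennreal (exp (- a) * b)
          \<le> ennreal (exp (- a) * (a / k) * b) + ennreal (exp s) * I X"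
        by (simp only: add.commute)
      then have "ennreal (exp (- a) * b) \<le> ennreal (exp s) * I X"
        unfolding ennreal_add_left_cancel_le by simp
      then have "ennreal (exp (- s)) * ennreal (exp (- a) * b) \<le> ennreal (exp (- s)) * (ennreal (exp s) * I X)"
        by (intro mult_left_mono) auto
      also have "\<dots> = I X"
        by (simp add: mult.assoc[symmetric] ennreal_mult[symmetric] mult_exp_exp)
      also have "ennreal (exp (- s)) * ennreal (exp (- a) * b) = ennreal (b * exp (- (1 + D) * s))"
        using b by (simp add: ennreal_mult[symmetric] a_def exp_minus exp_add algebra_simps exp_diff divide_inverse)
      finally show "ennreal (b * exp (- (1 + D) * s)) \<le> I X" .
    qed
  qed
  have "emeasure (P0 n) {X\<in>space (P0 n). (\<integral>\<^sup>+\<theta>. ennreal (lik_ratio n \<theta> X) \<partial>Q) < ennreal (b * exp (- (1 + D) * s))}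
    \<le> emeasure (P0 n) {X\<in>space (P0 n). 1 \<le> ennreal (1 / (b * a powr k)) * H X}"
  proof (rule emeasure_mono_AE)
    show "AE X in P0 n. X \<in> {X\<in>space (P0 n). (\<integral>\<^sup>+\<theta>. ennreal (lik_ratio n \<theta> X) \<partial>Q) < ennreal (b * exp (- (1 + D) * s))}
      \<longrightarrow> X \<in> {X\<in>space (P0 n). 1 \<le> ennreal (1 / (b * a powr k)) * H X}"
      using key
    proof eventually_elim
      case (elim X)
      show ?case
      proof
        assume X: "X \<in> {X\<in>space (P0 n). (\<integral>\<^sup>+\<theta>. ennreal (lik_ratio n \<theta> X) \<partial>Q) < ennreal (b * exp (- (1 + D) * s))}"
        have "I X \<le> (\<integral>\<^sup>+\<theta>. ennreal (lik_ratio n \<theta> X) \<partial>Q)"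
          unfolding I_def by (intro nn_integral_mono) (auto simp: indicator_def)
        with X have "I X < ennreal (b * exp (- (1 + D) * s))" by auto
        with elim have "ennreal (b * a powr k) \<le> H X" by (meson linear not_le)
        then have "ennreal (1 / (b * a powr k)) * ennreal (b * a powr k) \<le> ennreal (1 / (b * a powr k)) * H X"
          by (intro mult_left_mono) auto
        moreover have "ennreal (1 / (b * a powr k)) * ennreal (b * a powr k) = 1"
          using a b by (simp add: ennreal_mult[symmetric])
        ultimately show "X \<in> {X\<in>space (P0 n). 1 \<le> ennreal (1 / (b * a powr k)) * H X}"
          using X by auto
      qed
    qed
  qed measurable
  also have "\<dots> \<le> ennreal (1 / (b * a powr k)) * (\<integral>\<^sup>+X. H X * indicator (space (P0 n)) X \<partial>P0 n)"
    by (rule nn_integral_Markov_inequality) auto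
  also have "(\<integral>\<^sup>+X. H X * indicator (space (P0 n)) X \<partial>P0 n) = (\<integral>\<^sup>+X. H X \<partial>P0 n)"
    by (intro nn_integral_cong) auto
  also have "ennreal (1 / (b * a powr k)) * (\<integral>\<^sup>+X. H X \<partial>P0 n) \<le> ennreal (1 / (b * a powr k)) * ennreal (s powr (k / 2) * b)"
    using EH by (intro mult_left_mono) auto
  also have "\<dots> = ennreal (1 / (D\<^sup>2 * s) powr (k / 2))"
  proof -
    have "a powr k = (a\<^sup>2) powr (k / 2)" using a by (simp add: powr_powr flip: powr_numeral)
    also have "a\<^sup>2 = (D\<^sup>2 * s) * s" by (simp add: a_def power2_eq_square)
    also have "\<dots> powr (k / 2) = (D\<^sup>2 * s) powr (k / 2) * s powr (k / 2)" by (rule powr_mult)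
    finally have "1 / (b * a powr k) * (s powr (k / 2) * b) = 1 / (D\<^sup>2 * s) powr (k / 2)"
      using b s by simp
    then show ?thesis using b by (simp add: ennreal_mult[symmetric])
  qed
  also have "\<dots> \<le> ennreal (1 / (D\<^sup>2 * s))"
  proof -
    have "(D\<^sup>2 * s) powr 1 \<le> (D\<^sup>2 * s) powr (k / 2)"
      using D k unfolding s_def by (intro powr_mono) auto
    then show ?thesis using D s by (intro ennreal_leI divide_left_mono) auto
  qed
  finally show ?thesis by (simp add: s_def b_def)
qed

section \<open>Tests and the posterior mean\<close>

lemma lr_stat_pos:
  assumes "c \<in> space T" "X \<in> space (P0 n)" "\<forall>i<n. 0 < p \<theta>\<^sub>0 i (X i)"
  shows "0 < lr_stat n c X"
  unfolding lr_stat_def root_ratio_def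
proof (intro prod_pos ballI)
  fix i assume "i \<in> {..<n}"
  then have "0 < p \<theta>\<^sub>0 i (X i)" "0 \<le> p c i (X i)"
    using assms dens_nonneg[OF assms(1) coord_space[OF assms(2)]] by auto
  then show "0 < (sqrt (p c i (X i)) + sqrt (p \<theta>\<^sub>0 i (X i)) / 10) / (sqrt (p \<theta>\<^sub>0 i (X i)) + sqrt (p c i (X i)) / 10)"
    by (intro divide_pos_pos add_nonneg_pos[of "sqrt (p c i (X i))"] add_pos_nonneg[of "sqrt (p \<theta>\<^sub>0 i (X i))"]) auto
qed

text \<open>The threshold \<open>exp (- 3/25 h\<^sup>2)\<close> is below 1 to favour the second kind of error, whose exponent
  has to exceed the constant 1/4 in the growth condition on the prior mass of the shells.\<close>

lemma test_type_I:
  assumes c: "c \<in> space T" and m: "(17 / 18)\<^sup>2 * m \<le> hell2_sum n c \<theta>\<^sub>0"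
  shows "emeasure (P0 n) {X\<in>space (P0 n). exp (- 3 / 25 * hell2_sum n c \<theta>\<^sub>0) \<le> lr_stat n c X} \<le> ennreal (exp (- m / 4))"
proof -
  let ?S = "hell2_sum n c \<theta>\<^sub>0"
  note [measurable] = lr_stat_measurable[OF c]
  have "{X\<in>space (P0 n). exp (- 3 / 25 * ?S) \<le> lr_stat n c X}
      \<subseteq> {X\<in>space (P0 n). 1 \<le> ennreal (exp (3 / 25 * ?S)) * ennreal (lr_stat n c X)}"
  proof safe
    fix X assume le: "exp (- 3 / 25 * ?S) \<le> lr_stat n c X"
    have "1 = exp (3 / 25 * ?S) * exp (- 3 / 25 * ?S)" by (simp add: mult_exp_exp)
    also have "\<dots> \<le> exp (3 / 25 * ?S) * lr_stat n c X" using le by (intro mult_left_mono) auto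
    finally have "ennreal 1 \<le> ennreal (exp (3 / 25 * ?S) * lr_stat n c X)" by (rule ennreal_leI)
    then show "1 \<le> ennreal (exp (3 / 25 * ?S)) * ennreal (lr_stat n c X)" by (simp add: ennreal_mult')
  qed
  then have "emeasure (P0 n) {X\<in>space (P0 n). exp (- 3 / 25 * ?S) \<le> lr_stat n c X}
      \<le> emeasure (P0 n) {X\<in>space (P0 n). 1 \<le> ennreal (exp (3 / 25 * ?S)) * ennreal (lr_stat n c X)}"
    by (intro emeasure_mono) auto
  also have "\<dots> \<le> ennreal (exp (3 / 25 * ?S)) * (\<integral>\<^sup>+X. ennreal (lr_stat n c X) * indicator (space (P0 n)) X \<partial>P0 n)"
    by (rule nn_integral_Markov_inequality) auto
  also have "(\<integral>\<^sup>+X. ennreal (lr_stat n c X) * indicator (space (P0 n)) X \<partial>P0 n) = (\<integral>\<^sup>+X. ennreal (lr_stat n c X) \<partial>P0 n)"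
    by (intro nn_integral_cong) auto
  also have "ennreal (exp (3 / 25 * ?S)) * \<dots> \<le> ennreal (exp (3 / 25 * ?S)) * ennreal (exp (- 9 / 22 * ?S))"
    by (intro mult_left_mono lr_stat_mean c) auto
  also have "\<dots> = ennreal (exp (3 / 25 * ?S + (- 9 / 22 * ?S)))"
    by (simp only: ennreal_mult[symmetric] exp_ge_zero mult_exp_exp)
  \<comment> \<open>The net coefficient is (9/22 - 3/25) (17/18)^2, about 0.258, so 1/4 is reached
    with little to spare.\<close>
  also have "\<dots> \<le> ennreal (exp (- m / 4))"
    using m hell2_sum_nonneg[of n c \<theta>\<^sub>0] by (intro ennreal_leI) (simp add: power2_eq_square)
  finally show ?thesis .
qed

text \<open>The reverse triangle inequality on squared distances. The weights in
  \<open>hell2_sum_weighted_triangle\<close> are those for which the passage to squares loses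
  nothing: d >= r and distance at most r/18 to the centre give exactly 17 r/18.\<close>

lemma hell2_sum_centre:
  assumes "c \<in> space T" "\<theta> \<in> space T" "m \<le> hell2_sum n \<theta> \<theta>\<^sub>0" "hell2_sum n \<theta> c \<le> m / 324"
  shows "(17 / 18)\<^sup>2 * m \<le> hell2_sum n c \<theta>\<^sub>0"
  using hell2_sum_weighted_triangle[OF assms(2) true_param assms(1), of n] assms(3,4)
  by (simp add: power2_eq_square)

text \<open>On the acceptance region the likelihood ratio is at most the threshold times its
  quotient by \<open>lr_stat\<close>, whose mean is controlled. The threshold thus contributes its
  own exponent 3/25 to the bound.\<close>

lemma test_type_II:
  assumes c: "c \<in> space T" and \<theta>: "\<theta> \<in> space T"
    and m: "m \<le> hell2_sum n \<theta> \<theta>\<^sub>0" "hell2_sum n \<theta> c \<le> m / 324"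
  shows "(\<integral>\<^sup>+X. ennreal (lik_ratio n \<theta> X)
        * indicator {X. lr_stat n c X < exp (- 3 / 25 * hell2_sum n c \<theta>\<^sub>0)} X \<partial>P0 n) \<le> ennreal (exp (- 3 / 10 * m))"
proof -
  let ?S = "hell2_sum n c \<theta>\<^sub>0"
  have "(\<integral>\<^sup>+X. ennreal (lik_ratio n \<theta> X) * indicator {X. lr_stat n c X < exp (- 3 / 25 * ?S)} X \<partial>P0 n)
    \<le> (\<integral>\<^sup>+X. ennreal (exp (- 3 / 25 * ?S)) * ennreal (lik_ratio n \<theta> X / lr_stat n c X) \<partial>P0 n)"
  proof (rule nn_integral_mono_AE)
    show "AE X in P0 n. ennreal (lik_ratio n \<theta> X) * indicator {X. lr_stat n c X < exp (- 3 / 25 * ?S)} X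
      \<le> ennreal (exp (- 3 / 25 * ?S)) * ennreal (lik_ratio n \<theta> X / lr_stat n c X)"
      using AE_P0_dens_pos AE_space
    proof eventually_elim
      case (elim X)
      have pos: "0 < lr_stat n c X" by (rule lr_stat_pos[OF c elim(2,1)])
      have nn: "0 \<le> lik_ratio n \<theta> X" by (rule lik_ratio_nonneg[OF \<theta> elim(2)])
      show ?case
      proof (cases "lr_stat n c X < exp (- 3 / 25 * ?S)")
        case True
        have "lik_ratio n \<theta> X = lr_stat n c X * (lik_ratio n \<theta> X / lr_stat n c X)" using pos by simp
        also have "\<dots> \<le> exp (- 3 / 25 * ?S) * (lik_ratio n \<theta> X / lr_stat n c X)"
          using True pos nn by (intro mult_right_mono) auto
        finally have "ennreal (lik_ratio n \<theta> X) \<le> ennreal (exp (- 3 / 25 * ?S) * (lik_ratio n \<theta> X / lr_stat n c X))"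
          by (rule ennreal_leI)
        then show ?thesis using True by (simp only: ennreal_mult' exp_ge_zero indicator_simps mem_Collect_eq mult_1_right)
      qed simp
    qed
  qed
  also have "\<dots> = ennreal (exp (- 3 / 25 * ?S)) * (\<integral>\<^sup>+X. ennreal (lik_ratio n \<theta> X / lr_stat n c X) \<partial>P0 n)"
  proof (rule nn_integral_cmult)
    have "(\<lambda>X. lik_ratio n \<theta> X) \<in> borel_measurable (P0 n)"
      unfolding lik_ratio_def using \<theta>
      by (intro borel_measurable_prod borel_measurable_divide coord_compose_measurable) auto
    then show "(\<lambda>X. ennreal (lik_ratio n \<theta> X / lr_stat n c X)) \<in> borel_measurable (P0 n)"
      using lr_stat_measurable[OF c] by measurable
  qed
  also have "\<dots> \<le> ennreal (exp (- 3 / 25 * ?S)) * ennreal (exp (- (333 / 935) * ?S + 243 / 10 * hell2_sum n \<theta> c))"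
    by (intro mult_left_mono lr_stat_inverse_mean c \<theta>) auto
  also have "\<dots> = ennreal (exp (- 3 / 25 * ?S + (- (333 / 935) * ?S + 243 / 10 * hell2_sum n \<theta> c)))"
    by (simp only: ennreal_mult[symmetric] exp_ge_zero mult_exp_exp)
  also have "\<dots> \<le> ennreal (exp (- 3 / 10 * m))"
  proof -
    \<comment> \<open>The exponent is at least (3/25 + 333/935) (289/324) - (243/10)/324 times m,
      about 0.349. With threshold 1 it would be about 0.243, below the required 1/4.\<close>
    have "(17 / 18)\<^sup>2 * m \<le> ?S" by (rule hell2_sum_centre[OF c \<theta> m])
    then have "289 / 324 * m \<le> ?S" by (simp add: power2_eq_square)
    moreover have "0 \<le> m" using m(2) hell2_sum_nonneg[of n \<theta> c] by simp
    ultimately show ?thesis using m(2) by (intro ennreal_leI) simp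
  qed
  finally show ?thesis .
qed

section \<open>From likelihood ratios to the posterior\<close>

lemma posterior_le_1: "posterior p n Q X U \<le> 1"
proof -
  let ?a = "\<integral>\<^sup>+\<theta>\<in>U. ennreal (likelihood p n \<theta> X) \<partial>Q" and ?b = "\<integral>\<^sup>+\<theta>. ennreal (likelihood p n \<theta> X) \<partial>Q"
  have ab: "?a \<le> ?b" by (intro nn_integral_mono) (auto simp: indicator_def)
  show ?thesis
  proof (cases "?b = 0")
    case False
    then show ?thesis unfolding posterior_def
      using ab by (intro divide_le_posI_ennreal) (auto simp: zero_less_iff_neq_zero)
  qed (use ab in \<open>simp add: posterior_def\<close>)
qed

text \<open>Numerator and denominator of Bayes' formula share the factor
  \<open>likelihood p n \<theta>\<^sub>0 X\<close>, which is positive here; dropping it leaves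
  likelihood ratios, and \<open>K\<close> bounds the new denominator from below.\<close>

lemma posterior_le:
  assumes Q: "sets Q = sets T" and X: "X \<in> space (P0 n)" "\<forall>i<n. 0 < p \<theta>\<^sub>0 i (X i)"
    and U: "U \<in> sets T" and K: "0 < K" "ennreal K \<le> (\<integral>\<^sup>+\<theta>. ennreal (lik_ratio n \<theta> X) \<partial>Q)"
  shows "posterior p n Q X U \<le> ennreal (1 / K) * (\<integral>\<^sup>+\<theta>\<in>U. ennreal (lik_ratio n \<theta> X) \<partial>Q)"
proof -
  define L where "L = likelihood p n \<theta>\<^sub>0 X"
  have L: "0 < L" unfolding L_def likelihood_def using X by (intro prod_pos) auto
  have sp: "space Q = space T" using Q by (rule sets_eq_imp_space_eq)
  have fac: "ennreal (likelihood p n \<theta> X) = ennreal L * ennreal (lik_ratio n \<theta> X)" if "\<theta> \<in> space Q" for \<theta>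
  proof -
    have "L * lik_ratio n \<theta> X = (\<Prod>i<n. p \<theta>\<^sub>0 i (X i) * (p \<theta> i (X i) / p \<theta>\<^sub>0 i (X i)))"
      by (simp only: L_def likelihood_def lik_ratio_def prod.distrib)
    also have "\<dots> = likelihood p n \<theta> X"
      unfolding likelihood_def
    proof (intro prod.cong refl)
      fix i assume "i \<in> {..<n}"
      with X have "p \<theta>\<^sub>0 i (X i) \<noteq> 0" by fastforce
      then show "p \<theta>\<^sub>0 i (X i) * (p \<theta> i (X i) / p \<theta>\<^sub>0 i (X i)) = p \<theta> i (X i)" by simp
    qed
    finally show ?thesis using L by (simp add: ennreal_mult'[symmetric])
  qed
  have m: "(\<lambda>\<theta>. lik_ratio n \<theta> X) \<in> borel_measurable Q"
    using measurable_Pair_compose_split[OF lik_ratio_joint_measurable[OF Q] measurable_ident measurable_const[OF X(1)]]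
    by simp
  have den: "(\<integral>\<^sup>+\<theta>. ennreal (likelihood p n \<theta> X) \<partial>Q) = ennreal L * (\<integral>\<^sup>+\<theta>. ennreal (lik_ratio n \<theta> X) \<partial>Q)"
    using m by (subst nn_integral_cmult[symmetric]) (auto intro!: nn_integral_cong simp: fac)
  have num: "(\<integral>\<^sup>+\<theta>\<in>U. ennreal (likelihood p n \<theta> X) \<partial>Q) \<le> ennreal L * (\<integral>\<^sup>+\<theta>\<in>U. ennreal (lik_ratio n \<theta> X) \<partial>Q)"
    (is "?l \<le> _")
  proof -
    have "?l = (\<integral>\<^sup>+\<theta>. ennreal L * (ennreal (lik_ratio n \<theta> X) * indicator U \<theta>) \<partial>Q)"
      by (intro nn_integral_cong) (auto simp: fac mult.assoc)
    also have "\<dots> = ennreal L * (\<integral>\<^sup>+\<theta>\<in>U. ennreal (lik_ratio n \<theta> X) \<partial>Q)"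
      using m U Q by (intro nn_integral_cmult) auto
    finally show ?thesis by simp
  qed
  show ?thesis unfolding posterior_def
  proof (rule divide_le_posI_ennreal)
    have "0 < ennreal K" using K by simp
    also note K(2)
    finally have pos: "0 < (\<integral>\<^sup>+\<theta>. ennreal (lik_ratio n \<theta> X) \<partial>Q)" .
    then show "0 < (\<integral>\<^sup>+\<theta>. ennreal (likelihood p n \<theta> X) \<partial>Q)"
      unfolding den using L by (simp add: ennreal_zero_less_mult_iff)
    let ?I = "\<integral>\<^sup>+\<theta>. ennreal (lik_ratio n \<theta> X) \<partial>Q" and ?J = "\<integral>\<^sup>+\<theta>\<in>U. ennreal (lik_ratio n \<theta> X) \<partial>Q"
    have "1 = ennreal K * ennreal (1 / K)" using K by (simp add: ennreal_mult[symmetric])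
    also have "\<dots> \<le> ?I * ennreal (1 / K)" using K by (intro mult_right_mono) auto
    finally have "ennreal L * ?J * 1 \<le> ennreal L * ?J * (?I * ennreal (1 / K))"
      by (intro mult_left_mono) auto
    with num have "?l \<le> ennreal L * ?J * (?I * ennreal (1 / K))" by simp
    then show "?l \<le> (\<integral>\<^sup>+\<theta>. ennreal (likelihood p n \<theta> X) \<partial>Q) * (ennreal (1 / K) * ?J)"
      unfolding den by (simp add: mult_ac)
  qed
qed

text \<open>On the rejection event \<open>A\<close> and on the event of small evidence the posterior
  is bounded by 1. Elsewhere its numerator is split over \<open>N\<close> and the shells, and
  Tonelli's theorem moves the mean over observations inside. No test acts on \<open>N\<close>, whose
  contribution is its prior mass because the mean likelihood ratio is at most 1.\<close>

lemma posterior_mean_le: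
  fixes Q :: "'p measure" and S :: "nat \<Rightarrow> 'p set" and \<beta> :: "nat \<Rightarrow> ennreal"
  assumes Q: "sets Q = sets T" "prob_space Q" and K: "0 < K"
    and A: "A \<in> sets (P0 n)" and N: "N \<in> sets T" and S: "\<And>i. S i \<in> sets T"
    and U: "U \<in> sets T" "U \<subseteq> N \<union> (\<Union>i. S i)"
    and \<beta>: "\<And>i \<theta>. \<theta> \<in> S i \<Longrightarrow> (\<integral>\<^sup>+X. ennreal (lik_ratio n \<theta> X) * indicator (- A) X \<partial>P0 n) \<le> \<beta> i"
  shows "(\<integral>\<^sup>+X. posterior p n Q X U \<partial>P0 n) \<le> emeasure (P0 n) A
    + emeasure (P0 n) {X\<in>space (P0 n). (\<integral>\<^sup>+\<theta>. ennreal (lik_ratio n \<theta> X) \<partial>Q) < ennreal K}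
    + ennreal (1 / K) * (emeasure Q N + (\<Sum>i. \<beta> i * emeasure Q (S i)))"
proof -
  interpret Q: prob_space Q by fact
  interpret P0: prob_space "P0 n" by (rule prob_space_P0)
  interpret PS: pair_sigma_finite Q "P0 n" ..
  note [measurable] = A
  have NQ[measurable]: "N \<in> sets Q" and SQ[measurable]: "\<And>i. S i \<in> sets Q" and UQ[measurable]: "U \<in> sets Q"
    using N S U Q by auto
  have spQ: "space Q = space T" using Q(1) by (rule sets_eq_imp_space_eq)
  note lm[measurable] = lik_ratio_joint_measurable[OF Q(1), of n]
  have lm'[measurable]: "(\<lambda>(X, \<theta>). lik_ratio n \<theta> X) \<in> borel_measurable (P0 n \<Otimes>\<^sub>M Q)"
    using measurable_pair_swap[OF lm] by simp
  have lmX: "(\<lambda>\<theta>. lik_ratio n \<theta> X) \<in> borel_measurable Q" if "X \<in> space (P0 n)" for X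
    using measurable_Pair_compose_split[OF lm measurable_ident measurable_const[OF that]] by simp
  define E where "E = {X\<in>space (P0 n). (\<integral>\<^sup>+\<theta>. ennreal (lik_ratio n \<theta> X) \<partial>Q) < ennreal K}"
  have E[measurable]: "E \<in> sets (P0 n)" unfolding E_def by measurable
  define f where "f = (\<lambda>V X. \<integral>\<^sup>+\<theta>. ennreal (lik_ratio n \<theta> X) * indicator V \<theta> \<partial>Q)"
  have f[measurable]: "f V \<in> borel_measurable (P0 n)" if [measurable]: "V \<in> sets Q" for V
    unfolding f_def by measurable
  define W where "W = (\<lambda>X. f N X + (\<Sum>i. f (S i) X * indicator (- A) X))"
  have Am[measurable]: "(indicator (- A) :: _ \<Rightarrow> ennreal) \<in> borel_measurable (P0 n)"
  proof -
    \<comment> \<open>The complement \<open>- A\<close> is taken in the whole type and is in general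
      not a measurable set; on the space its indicator coincides with that of
      \<open>space (P0 n) - A\<close>.\<close>
    have "(indicator (space (P0 n) - A) :: _ \<Rightarrow> ennreal) \<in> borel_measurable (P0 n)" by measurable
    then show ?thesis by (rule measurable_cong[THEN iffD1, rotated]) (auto simp: indicator_def)
  qed
  have "(\<integral>\<^sup>+X. posterior p n Q X U \<partial>P0 n) \<le> (\<integral>\<^sup>+X. indicator A X + indicator E X + ennreal (1 / K) * W X \<partial>P0 n)"
  proof (rule nn_integral_mono_AE)
    show "AE X in P0 n. posterior p n Q X U \<le> indicator A X + indicator E X + ennreal (1 / K) * W X"
      using AE_P0_dens_pos AE_space
    proof eventually_elim
      case (elim X)
      consider "X \<in> A" | "X \<in> E" | "X \<notin> A" "X \<notin> E" by blast
      then show ?case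
      proof cases
        case 1
        then have "1 \<le> indicator A X + indicator E X + ennreal (1 / K) * W X"
          by (auto simp: add.assoc intro: add_increasing2)
        with posterior_le_1 show ?thesis by (rule order_trans)
      next
        case 2
        then have "1 \<le> indicator A X + indicator E X + ennreal (1 / K) * W X"
          by (auto simp: add.assoc intro: add_increasing add_increasing2)
        with posterior_le_1 show ?thesis by (rule order_trans)
      next
        case 3
        then have "ennreal K \<le> (\<integral>\<^sup>+\<theta>. ennreal (lik_ratio n \<theta> X) \<partial>Q)"
          using elim(2) by (auto simp: E_def not_less)
        then have "posterior p n Q X U \<le> ennreal (1 / K) * f U X"
          unfolding f_def by (intro posterior_le Q K elim U)
        also have "f U X \<le> (\<integral>\<^sup>+\<theta>. ennreal (lik_ratio n \<theta> X) * indicator N \<theta>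
            + (\<Sum>i. ennreal (lik_ratio n \<theta> X) * indicator (S i) \<theta>) \<partial>Q)"
          unfolding f_def
        proof (rule nn_integral_mono)
          fix \<theta> assume "\<theta> \<in> space Q"
          show "ennreal (lik_ratio n \<theta> X) * indicator U \<theta> \<le> ennreal (lik_ratio n \<theta> X) * indicator N \<theta>
            + (\<Sum>i. ennreal (lik_ratio n \<theta> X) * indicator (S i) \<theta>)"
          proof (cases "\<theta> \<in> U \<and> \<theta> \<notin> N")
            case True
            with U obtain i where i: "\<theta> \<in> S i" by auto
            have "ennreal (lik_ratio n \<theta> X) = (\<Sum>j\<in>{i}. ennreal (lik_ratio n \<theta> X) * indicator (S j) \<theta>)"
              using i by simp
            also have "\<dots> \<le> (\<Sum>j. ennreal (lik_ratio n \<theta> X) * indicator (S j) \<theta>)"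
              by (intro sum_le_suminf) auto
            finally show ?thesis using True by simp
          qed (auto simp: indicator_def)
        qed
        also have "\<dots> = f N X + (\<Sum>i. f (S i) X)"
          unfolding f_def using lmX[OF elim(2)]
          by (subst nn_integral_add) (auto simp: nn_integral_suminf simp del: ennreal_suminf_cmult)
        also have "\<dots> = W X" using 3 by (simp add: W_def)
        finally show ?thesis using 3 by (simp add: mult_left_mono)
      qed
    qed
  qed
  also have "\<dots> = emeasure (P0 n) A + emeasure (P0 n) E + ennreal (1 / K) * (\<integral>\<^sup>+X. W X \<partial>P0 n)"
    unfolding W_def by (simp add: nn_integral_add nn_integral_cmult)
  also have "(\<integral>\<^sup>+X. W X \<partial>P0 n) = (\<integral>\<^sup>+X. f N X \<partial>P0 n) + (\<Sum>i. \<integral>\<^sup>+X. f (S i) X * indicator (- A) X \<partial>P0 n)"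
    unfolding W_def by (subst nn_integral_add) (auto simp: nn_integral_suminf simp del: ennreal_suminf_multc)
  also have "\<dots> \<le> emeasure Q N + (\<Sum>i. \<beta> i * emeasure Q (S i))"
  proof (intro add_mono suminf_le summableI)
    have "(\<integral>\<^sup>+X. f N X \<partial>P0 n) = (\<integral>\<^sup>+\<theta>. (\<integral>\<^sup>+X. ennreal (lik_ratio n \<theta> X) * indicator N \<theta> \<partial>P0 n) \<partial>Q)"
      unfolding f_def by (rule PS.Fubini') measurable
    also have "\<dots> \<le> (\<integral>\<^sup>+\<theta>. indicator N \<theta> \<partial>Q)"
      using lik_ratio_mean_le spQ by (intro nn_integral_mono) (auto simp: indicator_def)
    finally show "(\<integral>\<^sup>+X. f N X \<partial>P0 n) \<le> emeasure Q N" by simp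
    fix i
    have "(\<integral>\<^sup>+X. f (S i) X * indicator (- A) X \<partial>P0 n)
      = (\<integral>\<^sup>+X. (\<integral>\<^sup>+\<theta>. ennreal (lik_ratio n \<theta> X) * indicator (S i) \<theta> * indicator (- A) X \<partial>Q) \<partial>P0 n)"
      unfolding f_def using lmX by (intro nn_integral_cong nn_integral_multc[symmetric]) auto
    also have "\<dots> = (\<integral>\<^sup>+\<theta>. (\<integral>\<^sup>+X. ennreal (lik_ratio n \<theta> X) * indicator (S i) \<theta> * indicator (- A) X \<partial>P0 n) \<partial>Q)"
      by (rule PS.Fubini') measurable
    also have "\<dots> \<le> (\<integral>\<^sup>+\<theta>. \<beta> i * indicator (S i) \<theta> \<partial>Q)"
      using \<beta> by (intro nn_integral_mono) (auto simp: indicator_def)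
    also have "\<dots> = \<beta> i * emeasure Q (S i)"
      by (rule nn_integral_cmult_indicator) measurable
    finally show "(\<integral>\<^sup>+X. f (S i) X * indicator (- A) X \<partial>P0 n) \<le> \<beta> i * emeasure Q (S i)" .
  qed
  finally show ?thesis by (simp add: E_def mult_left_mono add_left_mono)
qed

end

section \<open>Contraction\<close>

text \<open>The infimum of a nonempty set in \<open>enat\<close> is attained, so a finite entropy
  bound produces an actual cover of at most that size.\<close>

lemma covering_number_obtain:
  assumes "log_enat (covering_number S d r A) \<le> ereal s"
  obtains F where "finite F" "F \<subseteq> S" "A \<subseteq> (\<Union>c\<in>F. {\<theta> \<in> S. d \<theta> c < r})" "real (card F) \<le> exp s"
proof -
  let ?X = "{enat (card F) | F. finite F \<and> F \<subseteq> S \<and> A \<subseteq> (\<Union>c\<in>F. {\<theta> \<in> S. d \<theta> c < r})}"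
  have ne: "?X \<noteq> {}"
  proof
    assume "?X = {}"
    then have "covering_number S d r A = \<infinity>"
      unfolding covering_number_def by (simp only: Inf_enat_def simp_thms if_True)
    with assms show False by (simp add: log_enat_def)
  qed
  then have "covering_number S d r A \<in> ?X"
    unfolding covering_number_def Inf_enat_def by (auto intro: LeastI)
  then obtain F where F: "covering_number S d r A = enat (card F)" "finite F" "F \<subseteq> S"
    "A \<subseteq> (\<Union>c\<in>F. {\<theta> \<in> S. d \<theta> c < r})" by blast
  have "real (card F) \<le> exp s"
  \<comment> \<open>An empty cover has logarithm -\<infinity>, from which nothing about
    \<open>ln\<close> can be read off.\<close>
  proof (cases "card F = 0")
    case False
    with assms F(1) have "ln (real (card F)) \<le> s" by (simp add: log_enat_def)
    then have "exp (ln (real (card F))) \<le> exp s" by (simp only: exp_le_cancel_iff)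
    then show ?thesis using False by simp
  qed simp
  with F that show ?thesis by blast
qed

context product_model begin

text \<open>The estimate at a single n, with everything that must be uniform in n isolated. The
  number q bounds s/40 from below, so the geometric ratio exp(-q) need not depend on n. One
  geometric series comes from the errors of the first kind and one from the shells; the other two
  terms are the failure of the evidence bound and the mass outside the sieve, divided by the
  evidence.\<close>

lemma posterior_contraction_bound:
  fixes Q :: "'p measure" and \<epsilon> D k C s q M :: real and J n :: nat
  defines "s \<equiv> real n * \<epsilon>\<^sup>2"
  defines "B \<equiv> KL_nbhd \<mu> p (space T) C n \<theta>\<^sub>0 \<epsilon> k"
  defines "d \<equiv> hellinger_avg \<mu> p n"
  assumes Q: "sets Q = sets T" "prob_space Q" and n: "1 \<le> n" and C: "mz_constant k C" and k: "2 \<le> k"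
    and \<epsilon>: "0 < \<epsilon>" and D: "0 < D" "1 \<le> D\<^sup>2 * s" and pos: "0 < measure Q B"
    and sieve: "\<Theta>n \<in> sets T"
    and entropy: "(SUP e\<in>{\<epsilon><..}. log_enat (covering_number (space T) d (e / 36) {\<theta> \<in> \<Theta>n. d \<theta> \<theta>\<^sub>0 < e})) \<le> ereal s"
    and mass: "\<And>j. J \<le> j \<Longrightarrow> measure Q {\<theta> \<in> \<Theta>n. real j * \<epsilon> < d \<theta> \<theta>\<^sub>0 \<and> d \<theta> \<theta>\<^sub>0 \<le> 2 * real j * \<epsilon>} / measure Q B
        \<le> exp (s * (real j)\<^sup>2 / 4)"
    and J: "3 \<le> J" "40 * (1 + D) \<le> (real J)\<^sup>2" and q: "0 < q" "q \<le> s / 40" and M: "real J < M"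
  shows "(\<integral>\<^sup>+X. posterior p n Q X {\<theta> \<in> space T. d \<theta> \<theta>\<^sub>0 \<ge> M * \<epsilon>} \<partial>P0 n)
    \<le> ennreal (2 * exp (- q) ^ J / (1 - exp (- q)) + 1 / (D\<^sup>2 * s)
        + exp ((1 + D) * s) * (measure Q (space T - \<Theta>n) / measure Q B))"
proof -
  interpret Q: prob_space Q by fact
  interpret P0: prob_space "P0 n" by (rule prob_space_P0)
  have s: "0 < s" using n \<epsilon> by (simp add: s_def)
  have spQ: "space Q = space T" using Q(1) by (rule sets_eq_imp_space_eq)
  define b where "b = measure Q B"
  have b: "0 < b" using pos by (simp add: b_def)
  have dm[measurable]: "(\<lambda>\<theta>. d \<theta> \<theta>\<^sub>0) \<in> borel_measurable T"
    unfolding d_def by (rule hellinger_measurable)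
  note [measurable] = sieve
  have sT: "\<theta> \<in> space T" if "\<theta> \<in> \<Theta>n" for \<theta> using that sieve sets.sets_into_space by blast
  have d0: "0 \<le> d \<theta> \<theta>'" for \<theta> \<theta>' unfolding d_def by (rule hellinger_avg_nonneg)
  define m where "m = (\<lambda>j. s * (real j)\<^sup>2)"
  define S where "S = (\<lambda>j. {\<theta> \<in> \<Theta>n. real j * \<epsilon> < d \<theta> \<theta>\<^sub>0 \<and> d \<theta> \<theta>\<^sub>0 \<le> real (Suc j) * \<epsilon>})"
  have Sm: "S j \<in> sets T" for j
  proof -
    have "S j = {\<theta> \<in> space T. \<theta> \<in> \<Theta>n \<and> real j * \<epsilon> < d \<theta> \<theta>\<^sub>0 \<and> d \<theta> \<theta>\<^sub>0 \<le> real (Suc j) * \<epsilon>}"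
      using sT by (auto simp: S_def)
    also have "\<dots> \<in> sets T" by measurable
    finally show ?thesis .
  qed
  define Cov where "Cov = (\<lambda>j F. finite F \<and> F \<subseteq> space T \<and> S j \<subseteq> (\<Union>c\<in>F. {\<theta> \<in> space T. d \<theta> c < real j * \<epsilon> / 18})
    \<and> real (card F) \<le> exp s)"
  have Cov: "\<exists>F. Cov j F"
    if j: "J \<le> j" for j
  proof -
    have "3 \<le> j" using J j by simp
    then have lt: "\<epsilon> < 2 * real j * \<epsilon>" "real (Suc j) * \<epsilon> < 2 * real j * \<epsilon>"
      using \<epsilon> by (simp_all)
    \<comment> \<open>The entropy condition requires a radius above eps and concerns open balls
      around theta_0; 2 j eps meets the former and contains the closed outer edge (j + 1) eps of the
      shell.\<close>
    then have "log_enat (covering_number (space T) d (2 * real j * \<epsilon> / 36) {\<theta> \<in> \<Theta>n. d \<theta> \<theta>\<^sub>0 < 2 * real j * \<epsilon>}) \<le> ereal s"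
      by (intro order_trans[OF SUP_upper entropy]) auto
    then obtain F where F: "finite F" "F \<subseteq> space T" "real (card F) \<le> exp s"
      "{\<theta> \<in> \<Theta>n. d \<theta> \<theta>\<^sub>0 < 2 * real j * \<epsilon>} \<subseteq> (\<Union>c\<in>F. {\<theta> \<in> space T. d \<theta> c < 2 * real j * \<epsilon> / 36})"
      by (rule covering_number_obtain) blast
    have "S j \<subseteq> {\<theta> \<in> \<Theta>n. d \<theta> \<theta>\<^sub>0 < 2 * real j * \<epsilon>}" using lt by (auto simp: S_def)
    with F have "S j \<subseteq> (\<Union>c\<in>F. {\<theta> \<in> space T. d \<theta> c < 2 * real j * \<epsilon> / 36})" by blast
    also have "2 * real j * \<epsilon> / 36 = real j * \<epsilon> / 18" by simp
    finally show ?thesis unfolding Cov_def using F by blast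
  qed
  define F where "F = (\<lambda>j. SOME F. Cov j F)"
  have CF: "Cov j (F j)" if "J \<le> j" for j
    unfolding F_def by (rule someI_ex) (rule Cov[OF that])
  have F: "finite (F j)" "F j \<subseteq> space T" "S j \<subseteq> (\<Union>c\<in>F j. {\<theta> \<in> space T. d \<theta> c < real j * \<epsilon> / 18})"
    "real (card (F j)) \<le> exp s" if "J \<le> j" for j
    using CF[OF that] unfolding Cov_def by blast+
  define Rej where "Rej = (\<lambda>c. {X\<in>space (P0 n). exp (- 3 / 25 * hell2_sum n c \<theta>\<^sub>0) \<le> lr_stat n c X})"
  have Rej: "Rej c \<in> sets (P0 n)" if "c \<in> space T" for c
    unfolding Rej_def by (intro borel_measurable_le borel_measurable_const lr_stat_measurable that)
  \<comment> \<open>A cover may contain centres too close to theta_0 for the bound on the first kind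
    of error. They are discarded at no loss, since every ball that meets the shell has a distant
    centre by \<open>hell2_sum_centre\<close>.\<close>
  define G where "G = (\<lambda>j. {c \<in> F j. (17 / 18)\<^sup>2 * m j \<le> hell2_sum n c \<theta>\<^sub>0})"
  define A where "A = (\<Union>i. \<Union>c\<in>G (J + i). Rej c)"
  have Gfin: "finite (G (J + i))" "G (J + i) \<subseteq> space T" "real (card (G (J + i))) \<le> exp s" for i
  proof -
    show "finite (G (J + i))" "G (J + i) \<subseteq> space T" using F[of "J + i"] by (auto simp: G_def)
    have "card (G (J + i)) \<le> card (F (J + i))"
      using F(1)[of "J + i"] by (intro card_mono) (auto simp: G_def)
    then show "real (card (G (J + i))) \<le> exp s" using F(4)[of "J + i"] by linarith
  qed
  have Am1: "(\<Union>c\<in>G (J + i). Rej c) \<in> sets (P0 n)" for i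
    using Gfin[of i] Rej by (intro sets.finite_UN) auto
  then have Am: "A \<in> sets (P0 n)" unfolding A_def by (intro sets.countable_UN) auto
  let ?\<rho> = "exp (- q)"
  have \<rho>: "0 < ?\<rho>" "?\<rho> < 1" using q by auto
  \<comment> \<open>Since j <= j^2, the quadratic exponent dominates a linear one, which turns the
    bounds on the shells into a geometric series.\<close>
  have m_lower: "q * real j \<le> m j / 40" if "J \<le> j" for j
  proof -
    have "real j \<le> (real j)\<^sup>2" using J that by (simp add: power2_eq_square)
    then have "q * real j \<le> s / 40 * (real j)\<^sup>2" using q s by (intro mult_mono) auto
    then show ?thesis by (simp add: m_def)
  qed
  have sJ: "s * (real J)\<^sup>2 \<le> m j" if "J \<le> j" for j
    using that s unfolding m_def by (intro mult_left_mono power_mono) auto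
  have A_bound: "emeasure (P0 n) A \<le> (\<Sum>i. ennreal (?\<rho> ^ (J + i)))"
  proof -
    have "emeasure (P0 n) A \<le> (\<Sum>i. emeasure (P0 n) (\<Union>c\<in>G (J + i). Rej c))"
      unfolding A_def using Am1 by (intro emeasure_subadditive_countably) auto
    also have "\<dots> \<le> (\<Sum>i. ennreal (?\<rho> ^ (J + i)))"
    proof (intro suminf_le summableI)
      fix i
      let ?j = "J + i"
      have "emeasure (P0 n) (\<Union>c\<in>G ?j. Rej c) \<le> (\<Sum>c\<in>G ?j. emeasure (P0 n) (Rej c))"
        using Gfin[of i] Rej by (intro emeasure_subadditive_finite) auto
      also have "\<dots> \<le> (\<Sum>c\<in>G ?j. ennreal (exp (- m ?j / 4)))"
        using Gfin(2)[of i] unfolding Rej_def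
        by (intro sum_mono test_type_I) (auto simp: G_def)
      also have "\<dots> = ennreal (real (card (G ?j)) * exp (- m ?j / 4))"
        by (simp add: ennreal_mult ennreal_of_nat_eq_real_of_nat)
      also have "\<dots> \<le> ennreal (exp (- q * real ?j))"
      proof (intro ennreal_leI)
        have "real (card (G ?j)) * exp (- m ?j / 4) \<le> exp s * exp (- m ?j / 4)"
          using Gfin(3)[of i] by (intro mult_right_mono) auto
        also have "\<dots> = exp (s - m ?j / 4)" by (simp add: mult_exp_exp)
        also have "\<dots> \<le> exp (- q * real ?j)"
        proof -
          \<comment> \<open>With s <= m/9 the entropy factor is absorbed: s - m/4 <= -5 m/36 <=
            -m/40.\<close>
          have "9 \<le> (real J)\<^sup>2" using power_mono[of 3 "real J" 2] J by simp
          then have "s * 9 \<le> s * (real J)\<^sup>2" using s by (intro mult_left_mono) auto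
          with sJ[of ?j] have "9 * s \<le> m ?j" by simp
          with m_lower[of ?j] s show ?thesis by simp
        qed
        finally show "real (card (G ?j)) * exp (- m ?j / 4) \<le> exp (- q * real ?j)" .
      qed
      also have "exp (- q * real ?j) = ?\<rho> ^ ?j" by (simp add: exp_of_nat_mult[symmetric] mult.commute)
      finally show "emeasure (P0 n) (\<Union>c\<in>G ?j. Rej c) \<le> ennreal (?\<rho> ^ ?j)" .
    qed
    finally show ?thesis .
  qed
  define \<beta> where "\<beta> = (\<lambda>i. ennreal (exp (- 3 / 10 * m (J + i))))"
  have \<beta>: "(\<integral>\<^sup>+X. ennreal (lik_ratio n \<theta> X) * indicator (- A) X \<partial>P0 n) \<le> \<beta> i" if \<theta>: "\<theta> \<in> S (J + i)" for i \<theta>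
  proof -
    let ?j = "J + i"
    obtain c where c: "c \<in> F ?j" "d \<theta> c < real ?j * \<epsilon> / 18" using F(3)[of ?j] \<theta> by auto
    have \<theta>T: "\<theta> \<in> space T" using \<theta> sT by (auto simp: S_def)
    have cT: "c \<in> space T" using F(2)[of ?j] c by auto
    have "(real ?j * \<epsilon>)\<^sup>2 \<le> (d \<theta> \<theta>\<^sub>0)\<^sup>2" using \<theta> \<epsilon> by (intro power_mono) (auto simp: S_def)
    then have m1: "m ?j \<le> hell2_sum n \<theta> \<theta>\<^sub>0"
      unfolding hell2_sum_eq[OF n] m_def s_def d_def using n by (simp add: power_mult_distrib mult.commute)
    have "(d \<theta> c)\<^sup>2 \<le> (real ?j * \<epsilon> / 18)\<^sup>2" using c d0 by (intro power_mono) auto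
    then have "real n * (d \<theta> c)\<^sup>2 \<le> real n * (real ?j * \<epsilon> / 18)\<^sup>2" by (intro mult_left_mono) auto
    then have m2: "hell2_sum n \<theta> c \<le> m ?j / 324"
      unfolding hell2_sum_eq[OF n] m_def s_def d_def
      by (simp add: power_mult_distrib power_divide mult_ac)
    have cG: "c \<in> G ?j" using c hell2_sum_centre[OF cT \<theta>T m1 m2] by (simp add: G_def)
    have "(\<integral>\<^sup>+X. ennreal (lik_ratio n \<theta> X) * indicator (- A) X \<partial>P0 n)
      \<le> (\<integral>\<^sup>+X. ennreal (lik_ratio n \<theta> X) * indicator {X. lr_stat n c X < exp (- 3 / 25 * hell2_sum n c \<theta>\<^sub>0)} X \<partial>P0 n)"
    proof (intro nn_integral_mono mult_left_mono)
      fix X assume X: "X \<in> space (P0 n)"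
      have "lr_stat n c X < exp (- 3 / 25 * hell2_sum n c \<theta>\<^sub>0)" if "X \<notin> A"
        using that cG X by (auto simp: A_def Rej_def not_le)
      then show "indicator (- A) X \<le> (indicator {X. lr_stat n c X < exp (- 3 / 25 * hell2_sum n c \<theta>\<^sub>0)} X :: ennreal)"
        by (auto simp: indicator_def)
    qed simp
    also have "\<dots> \<le> \<beta> i" unfolding \<beta>_def by (rule test_type_II[OF cT \<theta>T m1 m2])
    finally show ?thesis .
  qed
  define K where "K = b * exp (- (1 + D) * s)"
  have K: "0 < K" using b by (simp add: K_def)
  have "K * exp ((1 + D) * s) = b" by (simp add: K_def mult.assoc mult_exp_exp) (simp add: algebra_simps)
  then have invK: "1 / K = exp ((1 + D) * s) / b" using b K by (simp add: field_simps)
  let ?U = "{\<theta> \<in> space T. d \<theta> \<theta>\<^sub>0 \<ge> M * \<epsilon>}" and ?N = "space T - \<Theta>n"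
  have U: "?U \<subseteq> ?N \<union> (\<Union>i. S (J + i))"
  proof
    fix \<theta> assume \<theta>: "\<theta> \<in> ?U"
    show "\<theta> \<in> ?N \<union> (\<Union>i. S (J + i))"
    proof (cases "\<theta> \<in> \<Theta>n")
      case True
      \<comment> \<open>Shells are open on the inside and closed on the outside, so a point with d /
        eps an integer belongs to the shell below; hence the ceiling minus 1.\<close>
      let ?j = "nat \<lceil>d \<theta> \<theta>\<^sub>0 / \<epsilon>\<rceil> - 1"
      have "real J < d \<theta> \<theta>\<^sub>0 / \<epsilon>"
        using \<theta> M \<epsilon> by (simp add: pos_less_divide_eq) (meson mult_strict_right_mono order_less_le_trans)
      then have j: "J \<le> ?j" "real ?j < d \<theta> \<theta>\<^sub>0 / \<epsilon>" "d \<theta> \<theta>\<^sub>0 / \<epsilon> \<le> real (Suc ?j)" by linarith+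
      have "\<theta> \<in> S ?j" using True j \<epsilon> by (simp add: S_def pos_less_divide_eq pos_divide_le_eq)
      then have "\<theta> \<in> S (J + (?j - J))" by (subst le_add_diff_inverse[OF j(1)])
      then show ?thesis by blast
    qed (use \<theta> in auto)
  qed
  have Um: "?U \<in> sets T" by measurable
  have Nm: "?N \<in> sets T" by measurable
  have shell_term: "ennreal (1 / K) * (\<beta> i * emeasure Q (S (J + i))) \<le> ennreal (?\<rho> ^ (J + i))" for i
  proof -
    let ?j = "J + i"
    have "S ?j \<subseteq> {\<theta> \<in> \<Theta>n. real ?j * \<epsilon> < d \<theta> \<theta>\<^sub>0 \<and> d \<theta> \<theta>\<^sub>0 \<le> 2 * real ?j * \<epsilon>}" (is "_ \<subseteq> ?V")
    proof -
      have "real (Suc ?j) * \<epsilon> \<le> 2 * real ?j * \<epsilon>" using J \<epsilon> by (intro mult_right_mono) auto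
      then show ?thesis by (auto simp: S_def)
    qed
    moreover have "?V \<in> sets Q"
    proof -
      have "?V = {\<theta> \<in> space T. \<theta> \<in> \<Theta>n \<and> real ?j * \<epsilon> < d \<theta> \<theta>\<^sub>0 \<and> d \<theta> \<theta>\<^sub>0 \<le> 2 * real ?j * \<epsilon>}"
        using sT by auto
      also have "\<dots> \<in> sets T" by measurable
      finally show ?thesis using Q by simp
    qed
    ultimately have "measure Q (S ?j) \<le> measure Q ?V" by (intro Q.finite_measure_mono)
    then have "measure Q (S ?j) / b \<le> measure Q ?V / b" using b by (intro divide_right_mono) auto
    also have "\<dots> \<le> exp (m ?j / 4)" using mass[of ?j] by (simp add: b_def m_def)
    finally have Sb: "measure Q (S ?j) / b \<le> exp (m ?j / 4)" .
    have "ennreal (1 / K) * (\<beta> i * emeasure Q (S ?j))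
      = ennreal (1 / K * (exp (- 3 / 10 * m ?j) * measure Q (S ?j)))"
      using K by (simp add: \<beta>_def Q.emeasure_eq_measure ennreal_mult[symmetric])
    also have "1 / K * (exp (- 3 / 10 * m ?j) * measure Q (S ?j))
      = exp ((1 + D) * s - 3 / 10 * m ?j) * (measure Q (S ?j) / b)"
    proof -
      have "exp ((1 + D) * s - 3 / 10 * m ?j) = exp ((1 + D) * s) * exp (- 3 / 10 * m ?j)"
        by (simp add: mult_exp_exp)
      then show ?thesis unfolding invK by simp
    qed
    also have "ennreal \<dots> \<le> ennreal (exp ((1 + D) * s - 3 / 10 * m ?j) * exp (m ?j / 4))"
      using Sb by (intro ennreal_leI mult_left_mono) auto
    also have "\<dots> = ennreal (exp ((1 + D) * s - m ?j / 20))" by (simp add: mult_exp_exp)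
    also have "\<dots> \<le> ennreal (exp (- q * real ?j))"
    proof -
      \<comment> \<open>The exponents 3/10 and 1/4 leave -m/20; the evidence takes at most m/40, and
        the remaining m/40 is at least q j.\<close>
      have "s * (40 * (1 + D)) \<le> s * (real J)\<^sup>2" using J(2) s by (intro mult_left_mono) auto
      with sJ[of ?j] have "40 * ((1 + D) * s) \<le> m ?j" by (simp add: algebra_simps)
      with m_lower[of ?j] have "(1 + D) * s - m ?j / 20 \<le> - q * real ?j" by simp
      then show ?thesis by (intro ennreal_leI) simp
    qed
    also have "exp (- q * real ?j) = ?\<rho> ^ ?j" by (simp add: exp_of_nat_mult[symmetric] mult.commute)
    finally show ?thesis .
  qed
  have geo: "(\<Sum>i. ennreal (?\<rho> ^ (J + i))) = ennreal (?\<rho> ^ J / (1 - ?\<rho>))"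
  proof -
    have "(\<lambda>i. ?\<rho> ^ J * ?\<rho> ^ i) sums (?\<rho> ^ J * (1 / (1 - ?\<rho>)))"
      using \<rho> by (intro sums_mult geometric_sums) auto
    then have "(\<lambda>i. ?\<rho> ^ (J + i)) sums (?\<rho> ^ J / (1 - ?\<rho>))" by (simp add: power_add)
    then show ?thesis by (intro suminf_ennreal_eq) auto
  qed
  have "(\<integral>\<^sup>+X. posterior p n Q X ?U \<partial>P0 n) \<le> emeasure (P0 n) A
    + emeasure (P0 n) {X\<in>space (P0 n). (\<integral>\<^sup>+\<theta>. ennreal (lik_ratio n \<theta> X) \<partial>Q) < ennreal K}
    + ennreal (1 / K) * (emeasure Q ?N + (\<Sum>i. \<beta> i * emeasure Q (S (J + i))))"
    by (intro posterior_mean_le Q K Am Nm Sm Um U \<beta>)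
  also have "\<dots> \<le> ennreal (?\<rho> ^ J / (1 - ?\<rho>)) + ennreal (1 / (D\<^sup>2 * s))
    + (ennreal (exp ((1 + D) * s) * (measure Q ?N / b)) + ennreal (?\<rho> ^ J / (1 - ?\<rho>)))"
  proof (intro add_mono)
    show "emeasure (P0 n) A \<le> ennreal (?\<rho> ^ J / (1 - ?\<rho>))" using A_bound by (simp only: geo)
    show "emeasure (P0 n) {X\<in>space (P0 n). (\<integral>\<^sup>+\<theta>. ennreal (lik_ratio n \<theta> X) \<partial>Q) < ennreal K} \<le> ennreal (1 / (D\<^sup>2 * s))"
      using evidence_lower_bound[OF Q n C k \<epsilon> D(1)] D(2) pos
      unfolding K_def b_def B_def s_def by blast
    have "ennreal (1 / K) * (emeasure Q ?N + (\<Sum>i. \<beta> i * emeasure Q (S (J + i))))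
      = ennreal (1 / K) * emeasure Q ?N + (\<Sum>i. ennreal (1 / K) * (\<beta> i * emeasure Q (S (J + i))))"
      by (simp add: distrib_left)
    also have "\<dots> \<le> ennreal (exp ((1 + D) * s) * (measure Q ?N / b)) + (\<Sum>i. ennreal (?\<rho> ^ (J + i)))"
    proof (intro add_mono suminf_le summableI shell_term)
      show "ennreal (1 / K) * emeasure Q ?N \<le> ennreal (exp ((1 + D) * s) * (measure Q ?N / b))"
        using b by (simp add: invK Q.emeasure_eq_measure ennreal_mult[symmetric])
    qed
    finally show "ennreal (1 / K) * (emeasure Q ?N + (\<Sum>i. \<beta> i * emeasure Q (S (J + i))))
      \<le> ennreal (exp ((1 + D) * s) * (measure Q ?N / b)) + ennreal (?\<rho> ^ J / (1 - ?\<rho>))"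
      by (simp only: geo)
  qed
  also have "\<dots> = ennreal (2 * ?\<rho> ^ J / (1 - ?\<rho>) + 1 / (D\<^sup>2 * s) + exp ((1 + D) * s) * (measure Q ?N / b))"
    using \<rho> s b by (subst ennreal_plus[symmetric], simp, simp)+ (simp add: algebra_simps)
  finally show ?thesis by (simp only: b_def)
qed

end

theorem theorem4:
  fixes \<mu> :: "nat \<Rightarrow> 'x measure"
    and T :: "'p measure"
    and p :: "'p \<Rightarrow> nat \<Rightarrow> 'x \<Rightarrow> real"
    and prior :: "nat \<Rightarrow> 'p measure"
    and \<theta>\<^sub>0 :: 'p
    and \<Theta>n :: "nat \<Rightarrow> 'p set"
    and \<epsilon> :: "nat \<Rightarrow> real"
    and k C :: real
  assumes sigma_finite: "\<And>i. sigma_finite_measure (\<mu> i)"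
    and dens_meas: "\<And>i. (\<lambda>(\<theta>, x). p \<theta> i x) \<in> borel_measurable (T \<Otimes>\<^sub>M \<mu> i)"
    and dens_nonneg: "\<And>\<theta> i x. \<theta> \<in> space T \<Longrightarrow> x \<in> space (\<mu> i) \<Longrightarrow> 0 \<le> p \<theta> i x"
    and dens_prob: "\<And>\<theta> i. \<theta> \<in> space T \<Longrightarrow> prob_space (law \<mu> p \<theta> i)"
    and prior_prob_space: "\<And>n. prob_space (prior n)"
    and prior_sets: "\<And>n. sets (prior n) = sets T"
    and true_param: "\<theta>\<^sub>0 \<in> space T"
    and k: "2 \<le> k"
    and C: "mz_constant k C"
    and sieve: "\<And>n. \<Theta>n n \<in> sets T"
    and eps_pos: "\<And>n. n \<ge> 1 \<Longrightarrow> 0 < \<epsilon> n"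
    and eps_lim: "\<epsilon> \<longlonglongrightarrow> 0"
    and eps_below: "\<exists>c>0. \<forall>n\<ge>1. c \<le> real n * (\<epsilon> n)\<^sup>2"
    and nbhd_pos: "\<And>n. n \<ge> 1 \<Longrightarrow> 0 < measure (prior n) (KL_nbhd \<mu> p (space T) C n \<theta>\<^sub>0 (\<epsilon> n) k)"
    and entropy: "\<And>n. n \<ge> 1 \<Longrightarrow>
      (SUP e\<in>{\<epsilon> n<..}. log_enat (covering_number (space T) (hellinger_avg \<mu> p n) (e / 36)
          {\<theta> \<in> \<Theta>n n. hellinger_avg \<mu> p n \<theta> \<theta>\<^sub>0 < e})) \<le> ereal (real n * (\<epsilon> n)\<^sup>2)"
    and remaining_mass:
      "(\<lambda>n. measure (prior n) (space T - \<Theta>n n)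
            / measure (prior n) (KL_nbhd \<mu> p (space T) C n \<theta>\<^sub>0 (\<epsilon> n) k))
         \<in> o(\<lambda>n. exp (- 2 * real n * (\<epsilon> n)\<^sup>2))"
    and prior_mass: "\<exists>J::nat. \<forall>j\<ge>J. \<forall>n\<ge>1.
      measure (prior n) {\<theta> \<in> \<Theta>n n. real j * \<epsilon> n < hellinger_avg \<mu> p n \<theta> \<theta>\<^sub>0 \<and>
                                hellinger_avg \<mu> p n \<theta> \<theta>\<^sub>0 \<le> 2 * real j * \<epsilon> n}
        / measure (prior n) (KL_nbhd \<mu> p (space T) C n \<theta>\<^sub>0 (\<epsilon> n) k)
      \<le> exp (real n * (\<epsilon> n)\<^sup>2 * (real j)\<^sup>2 / 4)"
  shows "\<forall>M :: nat \<Rightarrow> real. filterlim M at_top sequentially \<longrightarrow>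
    (\<lambda>n. \<integral>\<^sup>+X. posterior p n (prior n) X {\<theta> \<in> space T. hellinger_avg \<mu> p n \<theta> \<theta>\<^sub>0 \<ge> M n * \<epsilon> n}
          \<partial>joint_law \<mu> p n \<theta>\<^sub>0) \<longlonglongrightarrow> 0"
proof (intro allI impI)
  fix M :: "nat \<Rightarrow> real" assume M: "filterlim M at_top sequentially"
  interpret product_model \<mu> T p \<theta>\<^sub>0
    by (intro product_model.intro sigma_finite dens_meas dens_nonneg dens_prob true_param)
  define B where "B = (\<lambda>n. KL_nbhd \<mu> p (space T) C n \<theta>\<^sub>0 (\<epsilon> n) k)"
  define s where "s = (\<lambda>n. real n * (\<epsilon> n)\<^sup>2)"
  obtain c where c: "0 < c" "\<And>n. 1 \<le> n \<Longrightarrow> c \<le> s n" using eps_below unfolding s_def by blast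
  obtain J0 where J0: "\<And>j n. J0 \<le> j \<Longrightarrow> 1 \<le> n \<Longrightarrow>
      measure (prior n) {\<theta> \<in> \<Theta>n n. real j * \<epsilon> n < hellinger_avg \<mu> p n \<theta> \<theta>\<^sub>0 \<and>
                                hellinger_avg \<mu> p n \<theta> \<theta>\<^sub>0 \<le> 2 * real j * \<epsilon> n} / measure (prior n) (B n)
      \<le> exp (s n * (real j)\<^sup>2 / 4)"
    using prior_mass unfolding B_def s_def by blast
  show "(\<lambda>n. \<integral>\<^sup>+X. posterior p n (prior n) X {\<theta> \<in> space T. hellinger_avg \<mu> p n \<theta> \<theta>\<^sub>0 \<ge> M n * \<epsilon> n}
      \<partial>joint_law \<mu> p n \<theta>\<^sub>0) \<longlonglongrightarrow> 0"
  proof (rule tendsto_zero_ennreal)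
    fix r :: real assume "0 < r"
    \<comment> \<open>Three error terms are each brought to at most \<delta>, so 3 \<delta> < r
      suffices. The bound \<delta> <= 1 ensures that 1 / \<delta> <= D^2 s implies 1 <= D^2
      s.\<close>
    define \<delta> where "\<delta> = min r 1 / 4"
    have \<delta>: "0 < \<delta>" "3 * \<delta> < r" "\<delta> \<le> 1" using \<open>0 < r\<close> by (auto simp: \<delta>_def)
    define q where "q = c / 40"
    have q: "0 < q" using c by (simp add: q_def)
    \<comment> \<open>Chosen so that the failure probability 1 / (D^2 s) is at most \<delta>.
      Because s is bounded below by c, the values are at most \<open>Dmax\<close>, which lets
      \<open>J\<close> be chosen before n.\<close>
    define D where "D = (\<lambda>n. max 1 (1 / sqrt (\<delta> * s n)))"
    define Dmax where "Dmax = max 1 (1 / sqrt (\<delta> * c))"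
    have "(\<lambda>J. 2 * exp (- q) ^ J / (1 - exp (- q))) \<longlonglongrightarrow> 2 * 0 / (1 - exp (- q))"
      using q by (intro tendsto_intros LIMSEQ_power_zero) auto
    then have "\<forall>\<^sub>F J in sequentially. 2 * exp (- q) ^ J / (1 - exp (- q)) < \<delta>"
      using \<delta> by (intro order_tendstoD) auto
    moreover have "\<forall>\<^sub>F J in sequentially. 40 * (1 + Dmax) \<le> (real J)\<^sup>2"
    proof -
      have "filterlim (\<lambda>J. (real J)\<^sup>2) at_top sequentially"
        by (intro filterlim_pow_at_top filterlim_real_sequentially) auto
      then show ?thesis by (simp add: filterlim_at_top)
    qed
    ultimately have "\<forall>\<^sub>F J in sequentially. 2 * exp (- q) ^ J / (1 - exp (- q)) < \<delta> \<and> 40 * (1 + Dmax) \<le> (real J)\<^sup>2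
      \<and> max 3 J0 \<le> J"
      using eventually_ge_at_top[of "max 3 J0"] by eventually_elim auto
    then obtain J where J: "2 * exp (- q) ^ J / (1 - exp (- q)) < \<delta>" "40 * (1 + Dmax) \<le> (real J)\<^sup>2"
      "3 \<le> J" "J0 \<le> J"
      unfolding eventually_sequentially by auto
    \<comment> \<open>The little-o condition is used with a constant that contains exp(-1 /
      \<delta>), to offset the excess of (1 + D) s over 2 s.\<close>
    have ev1: "\<forall>\<^sub>F n in sequentially. measure (prior n) (space T - \<Theta>n n) / measure (prior n) (B n)
        \<le> \<delta> * exp (- 1 / \<delta>) * exp (- 2 * s n)"
    proof -
      have "\<forall>\<^sub>F n in sequentially. norm (measure (prior n) (space T - \<Theta>n n) / measure (prior n) (B n))
        \<le> (\<delta> * exp (- 1 / \<delta>)) * norm (exp (- 2 * real n * (\<epsilon> n)\<^sup>2))"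
        using \<delta> unfolding B_def by (intro landau_o.smallD[OF remaining_mass]) auto
      then show ?thesis by eventually_elim (simp add: s_def mult.assoc)
    qed
    have ev2: "\<forall>\<^sub>F n in sequentially. real J < M n"
      using M by (simp add: filterlim_at_top_dense)
    show "\<forall>\<^sub>F n in sequentially. (\<integral>\<^sup>+X. posterior p n (prior n) X {\<theta> \<in> space T. hellinger_avg \<mu> p n \<theta> \<theta>\<^sub>0 \<ge> M n * \<epsilon> n}
      \<partial>joint_law \<mu> p n \<theta>\<^sub>0) < ennreal r"
      using ev1 ev2 eventually_ge_at_top[of 1]
    proof eventually_elim
      case (elim n)
      have n: "1 \<le> n" by (rule elim(3))
      have s: "0 < s n" "c \<le> s n" using c n by (auto intro: less_le_trans)
      have D1: "1 \<le> D n" by (simp add: D_def)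
      have "sqrt (\<delta> * c) \<le> sqrt (\<delta> * s n)" using s \<delta> by simp
      then have "1 / sqrt (\<delta> * s n) \<le> 1 / sqrt (\<delta> * c)" using c \<delta> by (intro divide_left_mono) auto
      then have DJ: "40 * (1 + D n) \<le> (real J)\<^sup>2" using J(2) by (auto simp: D_def Dmax_def)
      have "(1 / sqrt (\<delta> * s n))\<^sup>2 \<le> (D n)\<^sup>2"
        using s \<delta> by (intro power_mono) (auto simp: D_def)
      then have "1 / (\<delta> * s n) \<le> (D n)\<^sup>2" using s \<delta> by (simp add: power_divide)
      then have Ds: "1 / \<delta> \<le> (D n)\<^sup>2 * s n" using s \<delta> by (simp add: field_simps)
      have "1 \<le> 1 / \<delta>" using \<delta> by simp
      then have D2: "1 \<le> (D n)\<^sup>2 * s n" using Ds by linarith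
      have D3: "1 / ((D n)\<^sup>2 * s n) \<le> \<delta>"
        using Ds D1 s \<delta> by (simp add: field_simps)
      \<comment> \<open>If D = 1, the left-hand side is 2 s. Otherwise \<delta> s < 1 and D s =
        sqrt(\<delta> s) / \<delta> < 1 / \<delta>: a large D occurs only when s is small.\<close>
      have D4: "(1 + D n) * s n \<le> 2 * s n + 1 / \<delta>"
      proof (cases "1 / sqrt (\<delta> * s n) \<le> 1")
        case True
        then show ?thesis using \<delta> by (simp add: D_def max_def)
      next
        case False
        define u where "u = sqrt (\<delta> * s n)"
        have u: "0 < u" "u < 1" "u\<^sup>2 = \<delta> * s n" using False s \<delta> by (auto simp: u_def)
        have Dn: "D n = 1 / u" using False by (simp add: D_def u_def max_def)
        have "D n * s n = u / \<delta>"
          using u \<delta> unfolding Dn by (simp add: power2_eq_square field_simps)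
        also have "\<dots> \<le> 1 / \<delta>" using u \<delta> by (intro divide_right_mono) auto
        finally show ?thesis using s by (simp add: algebra_simps)
      qed
      let ?ratio = "measure (prior n) (space T - \<Theta>n n) / measure (prior n) (B n)"
      have "exp ((1 + D n) * s n) * ?ratio \<le> exp (2 * s n + 1 / \<delta>) * (\<delta> * exp (- 1 / \<delta>) * exp (- 2 * s n))"
        using D4 elim(1) by (intro mult_mono) auto
      also have "\<dots> = \<delta>" by (simp add: exp_add exp_minus field_simps)
      finally have rem: "exp ((1 + D n) * s n) * ?ratio \<le> \<delta>" .
      have "(\<integral>\<^sup>+X. posterior p n (prior n) X {\<theta> \<in> space T. hellinger_avg \<mu> p n \<theta> \<theta>\<^sub>0 \<ge> M n * \<epsilon> n} \<partial>joint_law \<mu> p n \<theta>\<^sub>0)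
        \<le> ennreal (2 * exp (- q) ^ J / (1 - exp (- q)) + 1 / ((D n)\<^sup>2 * s n) + exp ((1 + D n) * s n) * ?ratio)"
        unfolding B_def s_def
      proof (rule posterior_contraction_bound[OF prior_sets prior_prob_space n C k eps_pos[OF n]])
        show "0 < D n" using D1 by simp
        show "1 \<le> (D n)\<^sup>2 * (real n * (\<epsilon> n)\<^sup>2)" using D2 by (simp add: s_def)
        show "0 < measure (prior n) (KL_nbhd \<mu> p (space T) C n \<theta>\<^sub>0 (\<epsilon> n) k)" by (rule nbhd_pos[OF n])
        show "\<Theta>n n \<in> sets T" by (rule sieve)
        show "(SUP e\<in>{\<epsilon> n<..}. log_enat (covering_number (space T) (hellinger_avg \<mu> p n) (e / 36)
          {\<theta> \<in> \<Theta>n n. hellinger_avg \<mu> p n \<theta> \<theta>\<^sub>0 < e})) \<le> ereal (real n * (\<epsilon> n)\<^sup>2)" by (rule entropy[OF n])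
        show "q \<le> real n * (\<epsilon> n)\<^sup>2 / 40" using s by (simp add: q_def s_def)
      qed (use J0 n J DJ q elim(2) in \<open>auto simp: B_def s_def\<close>)
      also have "\<dots> < ennreal r"
        using J(1) D3 rem \<delta> \<open>0 < r\<close> by (intro ennreal_lessI) linarith+
      finally show ?case .
    qed
  qed
qed

end
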